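(* Let $X_1,X_2,\dots$ be non-degenerate i.i.d. real random variables and $S_n=\sum_{i=1}^nX_i$, $S_0=0$. Suppose that either $\mathrm{P}(S_n\ge0)\to\rho$ with $0<\rho<1$, or $\mathrm{P}(S_n\ge0)\to0$ (put $\rho=0$) and $\sum_{k=1}^\infty\frac{\mathrm{P}(S_k\ge0)}{k}=\infty$. For $(x_1,x_2)\in\mathbb{R}^2$ let $R_n^{(x_1,x_2)}$ be the number of weak records with value no smaller than $x_2$ during the first $n$ steps of the random walk started at $x_1$. Then for every $(x_1,x_2)\in\mathbb{R}^2$, $$\limsup_{n\to\infty}\frac{R_n^{(x_1,x_2)}}{f\big(n/\log\log f(n)\big)\log\log f(n)}=\frac{\Gamma(\rho+1)}{\rho^\rho(1-\rho)^{1-\rho}}\quad\text{a.s.},$$ where $f(t)=\dfrac{t^\rho C_\rho(1-1/t)}{\Gamma(\rho+1)}$ for real $t\ge1$.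
   Context: The random walk started at $x_1$ is $(x_1+S_n)_{n\ge0}$. A weak record occurs at step $n$ if $x_1+S_n=\max_{0\le k\le n}(x_1+S_k)$, and its value is $x_1+S_n$; $R_n^{(x_1,x_2)}$ counts the steps $k\in\{0,1,\dots,n\}$ at which a weak record with value $\ge x_2$ occurs. For $0\le y<1$, $C_\rho(y)=\exp\big[\sum_{k=1}^\infty\frac{y^k}{k}(\mathrm{P}(S_k\ge0)-\rho)\big]$, with $S_k$ the walk started at $0$. Convention: $0^0=1$. *)

theory Defs
  imports "HOL-Probability.Probability"
begin

definition iid_from_1 :: "'a measure \<Rightarrow> (nat \<Rightarrow> 'a \<Rightarrow> real) \<Rightarrow> bool" where
  "iid_from_1 M X \<longleftrightarrow> prob_space.indep_vars M (\<lambda>_. borel) X {1..}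
     \<and> (\<forall>i\<ge>1. distr M borel (X i) = distr M borel (X 1))"

definition nondegenerate :: "'a measure \<Rightarrow> ('a \<Rightarrow> real) \<Rightarrow> bool" where
  "nondegenerate M Y \<longleftrightarrow> \<not> (\<exists>c. AE \<omega> in M. Y \<omega> = c)"

definition walk :: "(nat \<Rightarrow> 'a \<Rightarrow> real) \<Rightarrow> real \<Rightarrow> nat \<Rightarrow> 'a \<Rightarrow> real" where
  "walk X x n \<omega> = x + (\<Sum>i=1..n. X i \<omega>)"

definition weak_record :: "(nat \<Rightarrow> 'a \<Rightarrow> real) \<Rightarrow> real \<Rightarrow> nat \<Rightarrow> 'a \<Rightarrow> bool" where
  "weak_record X x n \<omega> \<longleftrightarrow> walk X x n \<omega> = Max ((\<lambda>k. walk X x k \<omega>) ` {0..n})"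

definition num_weak_records ::
    "(nat \<Rightarrow> 'a \<Rightarrow> real) \<Rightarrow> real \<Rightarrow> real \<Rightarrow> nat \<Rightarrow> 'a \<Rightarrow> nat" where
  "num_weak_records X x\<^sub>1 x\<^sub>2 n \<omega> =
     card {k \<in> {0..n}. weak_record X x\<^sub>1 k \<omega> \<and> walk X x\<^sub>1 k \<omega> \<ge> x\<^sub>2}"

definition prob_nonneg :: "'a measure \<Rightarrow> (nat \<Rightarrow> 'a \<Rightarrow> real) \<Rightarrow> nat \<Rightarrow> real" where
  "prob_nonneg M X k = measure M {\<omega> \<in> space M. walk X 0 k \<omega> \<ge> 0}"

(* Series over k >= 1, shifted to start at 0; meaningful for 0 <= y < 1. *)
definition C_fun :: "'a measure \<Rightarrow> (nat \<Rightarrow> 'a \<Rightarrow> real) \<Rightarrow> real \<Rightarrow> real \<Rightarrow> real" where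
  "C_fun M X \<rho> y =
     exp (\<Sum>k. y ^ Suc k / real (Suc k) * (prob_nonneg M X (Suc k) - \<rho>))"

(* Meaningful for t >= 1; values elsewhere are irrelevant in the limit n \<rightarrow> \<infinity>. *)
definition f_fun :: "'a measure \<Rightarrow> (nat \<Rightarrow> 'a \<Rightarrow> real) \<Rightarrow> real \<Rightarrow> real \<Rightarrow> real" where
  "f_fun M X \<rho> t = t powr \<rho> * C_fun M X \<rho> (1 - 1 / t) / Gamma (\<rho> + 1)"

(* Real power with 0^0 = 1; the library has 0 powr 0 = 0. *)
definition rpow :: "real \<Rightarrow> real \<Rightarrow> real" where
  "rpow a b = (if a = 0 \<and> b = 0 then 1 else a powr b)"

end

theory Submission
  imports Defs "HOL-Probability.Probability" "HOL-Real_Asymp.Real_Asymp"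
begin

text \<open>
  The weak records are the renewal epochs \<open>T\<^sub>m\<close> of the weak ascending ladder process, so that
  \<open>R\<^sub>n > m\<close> iff \<open>T\<^sub>m \<le> n\<close>. Rotating the first \<open>n\<close> steps gives the Sparre Andersen identity
  \<open>1 - E y\<^sup>T = exp (- \<Sum>k. y\<^sup>k P(S\<^sub>k \<ge> 0) / k)\<close> for the first epoch \<open>T\<close>, and \<open>P(S\<^sub>k \<ge> 0) \<rightarrow> \<rho>\<close> makes
  this regularly varying of index \<open>\<rho>\<close> at \<open>y = 1\<close>; in fact \<open>f t = 1 / (\<Gamma>(\<rho>+1) (1 - E (1 - 1/t)\<^sup>T))\<close>.
  With \<open>L = ln ln f n\<close> and \<open>g = f (n / L) L\<close>, Chernoff bounds at \<open>a L / n\<close> show that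
  \<open>P(T\<^sub>m \<le> n)\<close> for \<open>m \<approx> c g\<close> is \<open>exp (- (c a\<^sup>\<rho> / \<Gamma>(\<rho>+1) - a + o(1)) L)\<close> at \<open>a = \<rho> / (1 - \<rho>)\<close>
  whenever \<open>c\<close> is close to the claimed constant, where the exponent equals \<open>L\<close>. The matching lower
  bound needs no change of measure: Laplace transforms at \<open>(1 \<plusminus> \<kappa>) a L / n\<close> already force the
  main contribution to \<open>E exp (- a L T\<^sub>m / n)\<close> to come from a narrow range of \<open>T\<^sub>m\<close>. Both halves of the
  law then follow from Borel-Cantelli arguments, using independent blocks of ladder
  epochs for the lower one. Shifting the start and discarding records below \<open>x\<^sub>2\<close>
  changes the count by a bounded amount, since the walk is unbounded above.
\<close>

section \<open>Ladder epochs and the Sparre Andersen identity\<close>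

text \<open>Origin of the constant: for \<open>m\<close> near \<open>c * g n\<close> the Chernoff
  exponent is \<gamma> - a, where \<gamma> = c a^\<rho> / Gamma (\<rho> + 1). As a function of a it
  is maximal where a = \<rho> \<gamma>, with value (1 - \<rho>) \<gamma>. This is 1 when \<gamma> =
  1 / (1 - \<rho>) and a = \<rho> / (1 - \<rho>); solving for c gives the constant. The critical
  exponent is 1 because exp (- L n) = 1 / ln (f n), and along the steps that matter ln (f n) grows
  like k, up to logarithms, so the k-th probability is roughly k to the power minus the exponent.
  The obstacle is that only the limit of P(S_k >= 0) is known, and nothing about moments or tails of
  the steps. Hence every estimate uses Laplace transforms of the epochs alone, which the identity
  gives exactly, and no Tauberian theorem is involved. Divergence of the series of P(S_k >= 0) / k
  is what makes all epochs finite. For \<rho> = 0 the maximiser is a = 0, which is not admissible.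
  Both halves are therefore proved for every a > 0 that satisfies strict inequalities, and a
  suitable a is chosen only at the end.\<close>

definition psum :: "(nat \<Rightarrow> real) \<Rightarrow> nat \<Rightarrow> real" where
  "psum x n = (\<Sum>i<n. x i)"

definition ladder :: "(nat \<Rightarrow> real) \<Rightarrow> nat \<Rightarrow> bool" where
  "ladder x n \<longleftrightarrow> (\<forall>k\<le>n. psum x k \<le> psum x n)"

definition first_passage :: "(nat \<Rightarrow> real) \<Rightarrow> nat \<Rightarrow> bool" where
  "first_passage x j \<longleftrightarrow> 1 \<le> j \<and> 0 \<le> psum x j \<and> (\<forall>k\<in>{1..<j}. psum x k < 0)"

definition shift :: "nat \<Rightarrow> (nat \<Rightarrow> real) \<Rightarrow> nat \<Rightarrow> real" where
  "shift j x = (\<lambda>k. x (j + k))"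

text \<open>Indices from \<open>n\<close> on stay fixed, so that for a <= n this is an injection of
  all natural numbers, as \<open>prob_reindex\<close> requires.\<close>

definition rotation :: "nat \<Rightarrow> nat \<Rightarrow> nat \<Rightarrow> nat" where
  "rotation n a k = (if k < n - a then a + k else if k < n then k - (n - a) else k)"

text \<open>Index 0 is excluded so that the last maximum has \<open>n\<close> possible places, one
  for each rotation. Strictness after \<open>a\<close> turns into negativity of the first n - a sums
  of the rotated sequence.\<close>

definition last_argmax :: "(nat \<Rightarrow> real) \<Rightarrow> nat \<Rightarrow> nat \<Rightarrow> bool" where
  "last_argmax x n a \<longleftrightarrow> a \<in> {1..n} \<and> (\<forall>b\<in>{1..n}. psum x b \<le> psum x a) \<and>
     (\<forall>b\<in>{a<..n}. psum x b < psum x a)"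

section \<open>Partial sums under shifts and rotations\<close>

lemma psum_0 [simp]: "psum x 0 = 0"
  by (simp add: psum_def)

lemma psum_add: "psum x (j + k) = psum x j + psum (shift j x) k"
  by (simp add: psum_def shift_def sum.lessThan_Suc add.commute)
    (induction k; simp add: add_ac)

lemma psum_shift: "psum (shift j x) k = psum x (j + k) - psum x j"
  by (simp add: psum_add)

lemma shift_shift: "shift i (shift j x) = shift (j + i) x"
  by (simp add: shift_def add_ac)

lemma psum_cong: "(\<And>i. i < n \<Longrightarrow> x i = y i) \<Longrightarrow> psum x n = psum y n"
  by (simp add: psum_def)

lemma psum_rotation_le:
  assumes "a \<le> n" "k \<le> n - a"
  shows "psum (x \<circ> rotation n a) k = psum x (a + k) - psum x a"
proof -
  have "psum (x \<circ> rotation n a) k = psum (shift a x) k"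
    using assms by (intro psum_cong) (auto simp: rotation_def shift_def)
  then show ?thesis by (simp add: psum_shift)
qed

lemma psum_rotation_ge:
  assumes "a \<le> n" "b \<le> a"
  shows "psum (x \<circ> rotation n a) (n - a + b) = psum x n - psum x a + psum x b"
proof -
  have "psum (shift (n - a) (x \<circ> rotation n a)) b = psum x b"
    using assms by (intro psum_cong) (auto simp: rotation_def shift_def)
  moreover have "psum (x \<circ> rotation n a) (n - a) = psum x n - psum x a"
    using psum_rotation_le[of a n "n - a" x] assms(1) by (simp del: psum_add add: le_add_diff_inverse)
  ultimately show ?thesis unfolding psum_add by simp
qed

lemma inj_rotation: "a \<le> n \<Longrightarrow> inj (rotation n a)"
  by (auto simp: inj_on_def rotation_def split: if_splits)

text \<open>Starting the cyclic sequence just after its last maximum turns the condition on the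
  argument of the maximum into a condition on the first ladder epoch.\<close>
lemma rotation_last_argmax:
  assumes a: "a \<in> {1..n}"
  shows "ladder (x \<circ> rotation n a) n \<and> (\<forall>k\<in>{1..n - a}. psum (x \<circ> rotation n a) k < 0)
     \<longleftrightarrow> 0 \<le> psum x n \<and> last_argmax x n a" (is "?L \<longleftrightarrow> ?R")
proof -
  let ?y = "x \<circ> rotation n a"
  have n: "psum ?y n = psum x n"
    using psum_rotation_ge[of a n a x] a by simp
  have le: "psum ?y k = psum x (a + k) - psum x a" if "k \<le> n - a" for k
    using psum_rotation_le[of a n k x] a that by simp
  have ge: "psum ?y k = psum x n - psum x a + psum x (k - (n - a))" if "k \<le> n" "n - a \<le> k" for k
    using psum_rotation_ge[of a n "k - (n - a)" x] a that by simp
  show ?thesis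
  proof
    assume L: ?L
    have lad: "psum ?y k \<le> psum x n" if "k \<le> n" for k using L that n by (simp add: ladder_def)
    have 0: "0 \<le> psum x n" using lad[of 0] by simp
    have 1: "psum x b < psum x a" if "b \<in> {a<..n}" for b
    proof -
      have "b - a \<in> {1..n - a}" "a + (b - a) = b" using that by auto
      then show ?thesis using L le[of "b - a"] by (metis atLeastAtMost_iff diff_less_0_iff_less)
    qed
    have 2: "psum x b \<le> psum x a" if "b \<le> a" for b
      using lad[of "b + (n - a)"] ge[of "b + (n - a)"] that a by simp
    have "psum x b \<le> psum x a" if "b \<in> {1..n}" for b
      using 1[of b] 2[of b] that by (cases "b \<le> a") auto
    with 0 1 a show ?R by (auto simp: last_argmax_def)
  next
    assume R: ?R
    have "psum ?y k < 0" if "k \<in> {1..n - a}" for k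
      using R that le[of k] a by (auto simp: last_argmax_def)
    moreover have "psum ?y k \<le> psum x n" if k: "k \<le> n" for k
    proof (cases "k \<le> n - a")
      case True
      then have "psum x (a + k) \<le> psum x a" using R a k by (auto simp: last_argmax_def)
      then show ?thesis using le[OF True] R by simp
    next
      case False
      let ?b = "k - (n - a)"
      have "psum x ?b \<le> psum x a"
      proof (cases "?b = 0")
        case True
        have "psum x n \<le> psum x a" using R a by (simp add: last_argmax_def)
        with True R show ?thesis by simp
      next
        case False
        then have "?b \<in> {1..n}" using k by auto
        then show ?thesis using R unfolding last_argmax_def by blast
      qed
      then show ?thesis using ge[of k] False k by simp
    qed
    ultimately show ?L by (simp add: ladder_def n)
  qed
qed

lemma ex1_last_argmax:
  assumes "1 \<le> n" shows "\<exists>!a. last_argmax x n a"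
proof -
  let ?A = "{a\<in>{1..n}. \<forall>b\<in>{1..n}. psum x b \<le> psum x a}"
  have "finite (psum x ` {1..n})" "psum x ` {1..n} \<noteq> {}" using assms by auto
  then have "Max (psum x ` {1..n}) \<in> psum x ` {1..n}" by (rule Max_in)
  then obtain a where "a \<in> {1..n}" "psum x a = Max (psum x ` {1..n})" by auto
  then have "a \<in> ?A" by auto
  then have M: "Max ?A \<in> ?A" by (intro Max_in) (simp, blast)
  have "psum x b < psum x (Max ?A)" if b: "b \<in> {Max ?A<..n}" for b
  proof (rule ccontr)
    assume "\<not> ?thesis"
    then have "psum x (Max ?A) \<le> psum x b" by simp
    moreover have "\<forall>c\<in>{1..n}. psum x c \<le> psum x (Max ?A)" using M by blast
    ultimately have "\<forall>c\<in>{1..n}. psum x c \<le> psum x b" by fastforce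
    moreover have "b \<in> {1..n}" using b by simp
    ultimately have "b \<in> ?A" by blast
    then have "b \<le> Max ?A" by (intro Max_ge) auto
    then show False using b by simp
  qed
  then have "last_argmax x n (Max ?A)" using M unfolding last_argmax_def by blast
  moreover have "a = b" if "last_argmax x n a" "last_argmax x n b" for a b
  proof (cases a b rule: linorder_cases)
    case less
    then have "psum x b < psum x a" "psum x a \<le> psum x b"
      using that unfolding last_argmax_def by auto
    then show ?thesis by simp
  next
    case greater
    then have "psum x a < psum x b" "psum x b \<le> psum x a"
      using that unfolding last_argmax_def by auto
    then show ?thesis by simp
  qed
  ultimately show ?thesis by blast
qed

lemma ladder_imp_nonneg: "ladder x n \<Longrightarrow> 0 \<le> psum x n"
  by (auto simp: ladder_def dest: spec[of _ 0])

lemma first_passage_unique: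
  assumes "first_passage x i" "first_passage x j" shows "i = j"
proof (cases i j rule: linorder_cases)
  case less
  then have "psum x i < 0" "0 \<le> psum x i" using assms by (auto simp: first_passage_def)
  then show ?thesis by simp
next
  case greater
  then have "psum x j < 0" "0 \<le> psum x j" using assms by (auto simp: first_passage_def)
  then show ?thesis by simp
qed

text \<open>All sums before a first passage are negative, apart from the initial 0, and so do not
  exceed the sum at \<open>j\<close>. Whether a later step is a record is thus decided by the steps
  after \<open>j\<close>: this is the renewal property.\<close>

lemma ladder_first_passage:
  assumes "first_passage x j" "j \<le> n"
  shows "ladder x n \<longleftrightarrow> ladder (shift j x) (n - j)"
proof
  assume "ladder x n"
  then show "ladder (shift j x) (n - j)" using assms by (auto simp: ladder_def psum_shift)
next
  assume *: "ladder (shift j x) (n - j)"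
  then have ge: "psum x k \<le> psum x n" if "k \<in> {j..n}" for k
    using that assms(2) by (auto simp: ladder_def psum_shift dest!: spec[of _ "k - j"])
  have "psum x k \<le> psum x j" if "k < j" for k
  proof (cases "k = 0")
    case False
    then have "psum x k < 0" using that assms by (auto simp: first_passage_def)
    then show ?thesis using assms by (simp add: first_passage_def)
  qed (use assms in \<open>simp add: first_passage_def\<close>)
  then show "ladder x n" using ge[of j] ge assms(2)
    by (auto simp: ladder_def) (metis atLeastAtMost_iff le_less_linear order.trans order_refl)
qed

lemma nonneg_first_passage:
  assumes "1 \<le> n" "0 \<le> psum x n"
  shows "\<exists>j\<in>{1..n}. first_passage x j"
proof -
  let ?P = "\<lambda>j. 1 \<le> j \<and> 0 \<le> psum x j"
  have "?P (LEAST j. ?P j)" by (rule LeastI[of ?P n]) (use assms in simp)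
  moreover have "(LEAST j. ?P j) \<le> n" by (rule Least_le[of ?P n]) (use assms in simp)
  moreover have "psum x k < 0" if "k \<in> {1..<LEAST j. ?P j}" for k
    using not_less_Least[of k ?P] that by auto
  ultimately show ?thesis by (auto simp: first_passage_def)
qed

section \<open>Measurability on the sequence space\<close>

lemma borel_measurable_pred_le [measurable (raw)]:
  fixes g h :: "'a \<Rightarrow> real"
  assumes "g \<in> borel_measurable M" "h \<in> borel_measurable M"
  shows "Measurable.pred M (\<lambda>x. g x \<le> h x)"
  unfolding pred_def using assms by (rule borel_measurable_le)

abbreviation seq_borel :: "(nat \<Rightarrow> real) measure" where
  "seq_borel \<equiv> PiM UNIV (\<lambda>_::nat. borel)"

lemma measurable_psum [measurable]: "(\<lambda>x. psum x n) \<in> borel_measurable seq_borel"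
  unfolding psum_def by measurable

lemma measurable_ladder [measurable]: "Measurable.pred seq_borel (\<lambda>x. ladder x n)"
  unfolding ladder_def by measurable

lemma measurable_first_passage [measurable]: "Measurable.pred seq_borel (\<lambda>x. first_passage x n)"
  unfolding first_passage_def by measurable

lemma measurable_last_argmax [measurable]: "Measurable.pred seq_borel (\<lambda>x. last_argmax x n a)"
  unfolding last_argmax_def by measurable

lemma measurable_shift [measurable]: "shift j \<in> measurable seq_borel seq_borel"
  unfolding shift_def by (intro measurable_PiM_single') auto

lemma measurable_reindex: "(\<lambda>x. x \<circ> g) \<in> measurable seq_borel seq_borel"
  unfolding comp_def by (intro measurable_PiM_single') auto

section \<open>The path space of i.i.d. steps and the renewal equations\<close>

locale random_walk = prob_space D for D :: "real measure" +
  assumes sets_D: "sets D = sets borel"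
begin

definition W :: "(nat \<Rightarrow> real) measure" where "W = PiM UNIV (\<lambda>_::nat. D)"

lemma sets_W [measurable_cong]: "sets W = sets seq_borel"
  unfolding W_def by (intro sets_PiM_cong) (auto simp: sets_D)

lemma space_W [simp]: "space W = UNIV"
  using sets_eq_imp_space_eq[OF sets_W] by (simp add: space_PiM)

lemma sequence_space_D: "sequence_space D"
  by (simp add: sequence_space_def product_prob_space_def product_prob_space_axioms_def
      product_sigma_finite_def prob_space_axioms sigma_finite_measure_axioms)

sublocale W: prob_space W
  unfolding W_def by (intro prob_space_PiM prob_space_axioms)

lemma prob_reindex:
  assumes "inj g" "Measurable.pred W P"
  shows "W.prob {x. P (x \<circ> g)} = W.prob {x. P x}"
proof -
  have "distr W W (\<lambda>x. x \<circ> g) = W"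
    using distr_PiM_reindex[of UNIV "\<lambda>_. D" g UNIV, folded W_def] assms(1) prob_space_axioms
    by (simp add: comp_def restrict_UNIV W_def[symmetric])
  then have "W.prob {x. P x} = measure (distr W W (\<lambda>x. x \<circ> g)) {x. P x}" by simp
  also have "\<dots> = W.prob {x. P (x \<circ> g)}"
    using assms(2) measurable_reindex[of g] measurable_cong_sets[OF sets_W sets_W]
    by (subst measure_distr) (auto simp: pred_def vimage_def)
  finally show ?thesis by simp
qed

text \<open>\<open>comb_seq j\<close> glues the first \<open>j\<close> entries of one sequence to a
  second, independent one and maps the product of two copies of \<open>W\<close> to
  \<open>W\<close>. The preimage of the event is a rectangle.\<close>

lemma markov:
  assumes [measurable]: "Measurable.pred W P" "Measurable.pred W Q"
    and dep: "\<And>x y. (\<And>i. i < j \<Longrightarrow> x i = y i) \<Longrightarrow> P x = P y"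
  shows "W.prob {x. P x \<and> Q (shift j x)} = W.prob {x. P x} * W.prob {x. Q x}"
proof -
  let ?f = "\<lambda>(x, y). comb_seq j x y"
  have dep': "P (comb_seq j x y) = P x" for x y
    by (rule dep) (simp add: comb_seq_def)
  have shift: "shift j (comb_seq j x y) = y" for x y :: "nat \<Rightarrow> real"
    by (simp add: shift_def comb_seq_def)
  have [measurable]: "{x. P x \<and> Q (shift j x)} \<in> sets W"
  proof -
    have "Measurable.pred W (\<lambda>x. P x \<and> Q (shift j x))" by measurable
    then show ?thesis by (simp add: pred_def)
  qed
  have "W.prob {x. P x \<and> Q (shift j x)} = measure (distr (W \<Otimes>\<^sub>M W) W ?f) {x. P x \<and> Q (shift j x)}"
    by (simp add: sequence_space.PiM_comb_seq[OF sequence_space_D, folded W_def])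
  also have "\<dots> = measure (W \<Otimes>\<^sub>M W) ({x. P x} \<times> {x. Q x})"
    using measurable_comb_seq[of j D] unfolding W_def[symmetric]
    by (subst measure_distr)
      (auto simp: space_pair_measure case_prod_beta'  dep' shift intro!: arg_cong[where f="measure _"])
  also have "\<dots> = W.prob {x. P x} * W.prob {x. Q x}"
  proof -
    have "{x. P x} \<in> sets W" "{x. Q x} \<in> sets W"
      using assms(1,2) by (simp_all add: pred_def)
    then have "emeasure (W \<Otimes>\<^sub>M W) ({x. P x} \<times> {x. Q x}) = emeasure W {x. P x} * emeasure W {x. Q x}"
      by (rule W.emeasure_pair_measure_Times)
    then show ?thesis unfolding measure_def by (simp only: enn2real_mult)
  qed
  finally show ?thesis .
qed

lemma prob_shift:
  assumes "Measurable.pred W Q"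
  shows "W.prob {x. Q (shift j x)} = W.prob {x. Q x}"
  using markov[of "\<lambda>_. True" Q j] assms W.prob_space by simp

definition p :: "nat \<Rightarrow> real" where "p n = W.prob {x. 0 \<le> psum x n}"
definition f :: "nat \<Rightarrow> real" where "f j = W.prob {x. first_passage x j}"
text \<open>The renewal mass function generated by the epoch law \<open>f\<close>.\<close>

definition u :: "nat \<Rightarrow> real" where "u n = W.prob {x. ladder x n}"

lemma sets_Collect_W: "Measurable.pred W P \<Longrightarrow> {x. P x} \<in> sets W"
  by (simp add: pred_def)

lemma prob_one_iff:
  assumes "Measurable.pred W P" shows "W.prob {x. P x} = 1 \<longleftrightarrow> (AE x in W. P x)"
  using W.prob_eq_1[OF sets_Collect_W[OF assms]] by simp

lemma prob_zero_iff:
  assumes "Measurable.pred W P" shows "W.prob {x. P x} = 0 \<longleftrightarrow> (AE x in W. \<not> P x)"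
  using W.prob_eq_0[OF sets_Collect_W[OF assms]] by simp

lemma prob_True: "W.prob {x. True} = 1"
  using W.prob_space by simp

lemma first_passage_and_ladder:
  assumes "j \<le> n"
  shows "W.prob {x. first_passage x j \<and> ladder x n} = f j * u (n - j)"
proof -
  have "{x. first_passage x j \<and> ladder x n} = {x. first_passage x j \<and> ladder (shift j x) (n - j)}"
    using ladder_first_passage[OF _ assms] by blast
  also have "W.prob \<dots> = f j * u (n - j)"
    unfolding f_def u_def
  proof (rule markov)
    fix x y :: "nat \<Rightarrow> real"
    assume eq: "x i = y i" if "i < j" for i
    have "psum x k = psum y k" if "k \<le> j" for k
      using that by (intro psum_cong eq) simp
    then show "first_passage x j = first_passage y j"
      by (simp add: first_passage_def)
  qed auto
  finally show ?thesis .
qed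

text \<open>A record at \<open>n\<close> has a nonnegative sum, so a first passage j <= n exists;
  negativity up to \<open>i\<close> says exactly that j > i.\<close>

lemma ladder_not_before:
  assumes "i < n"
  shows "W.prob {x. ladder x n \<and> (\<forall>k\<in>{1..i}. psum x k < 0)} = (\<Sum>j\<in>{i<..n}. f j * u (n - j))"
proof -
  have "{x. ladder x n \<and> (\<forall>k\<in>{1..i}. psum x k < 0)} =
      (\<Union>j\<in>{i<..n}. {x. first_passage x j \<and> ladder x n})" (is "?L = ?R")
  proof (intro set_eqI iffI)
    fix x assume x: "x \<in> ?L"
    then obtain j where j: "j \<in> {1..n}" "first_passage x j"
      using nonneg_first_passage[of n x] ladder_imp_nonneg[of x n] assms by auto
    moreover have "i < j"
    proof (rule ccontr)
      assume "\<not> i < j"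
      then have "psum x j < 0" using x j by simp
      then show False using j by (simp add: first_passage_def)
    qed
    ultimately show "x \<in> ?R" using x by auto
  qed (auto simp: first_passage_def)
  also have "W.prob \<dots> = (\<Sum>j\<in>{i<..n}. W.prob {x. first_passage x j \<and> ladder x n})"
    by (intro W.finite_measure_finite_Union)
      (auto simp: disjoint_family_on_def intro!: sets_Collect_W dest: first_passage_unique)
  also have "\<dots> = (\<Sum>j\<in>{i<..n}. f j * u (n - j))"
    by (intro sum.cong) (auto simp: first_passage_and_ladder)
  finally show ?thesis .
qed

lemma u_renewal:
  assumes "1 \<le> n" shows "u n = (\<Sum>j=1..n. f j * u (n - j))"
proof -
  have "{1..n} = {0<..n}" by auto
  then show ?thesis using ladder_not_before[of 0 n] assms by (simp add: u_def)
qed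

text \<open>The event S_n >= 0 is split by the place \<open>a\<close> of the last maximum. Rotating
  by \<open>a\<close> preserves the law and gives the event that \<open>n\<close> is a record whose
  first passage \<open>j\<close> exceeds n - a. A given \<open>j\<close> occurs for exactly
  \<open>j\<close> values of \<open>a\<close>, which produces the factor
  \<open>real j\<close>.\<close>

lemma p_renewal:
  assumes "1 \<le> n" shows "p n = (\<Sum>j=1..n. real j * f j * u (n - j))"
proof -
  have "{x. 0 \<le> psum x n} = (\<Union>a\<in>{1..n}. {x. 0 \<le> psum x n \<and> last_argmax x n a})"
  proof -
    have "\<exists>a\<in>{1..n}. last_argmax x n a" for x
      using ex1_last_argmax[OF assms, of x] unfolding last_argmax_def by blast
    then show ?thesis by auto
  qed
  then have "p n = W.prob (\<Union>a\<in>{1..n}. {x. 0 \<le> psum x n \<and> last_argmax x n a})"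
    by (simp add: p_def)
  also have "\<dots> = (\<Sum>a=1..n. W.prob {x. 0 \<le> psum x n \<and> last_argmax x n a})"
    using ex1_last_argmax[OF assms]
    by (intro W.finite_measure_finite_Union)
      (auto simp: disjoint_family_on_def intro!: sets_Collect_W)
  also have "\<dots> = (\<Sum>a=1..n. \<Sum>j\<in>{n - a<..n}. f j * u (n - j))"
  proof (rule sum.cong)
    fix a assume a: "a \<in> {1..n}"
    let ?P = "\<lambda>x. ladder x n \<and> (\<forall>k\<in>{1..n - a}. psum x k < 0)"
    have "W.prob {x. 0 \<le> psum x n \<and> last_argmax x n a} = W.prob {x. ?P (x \<circ> rotation n a)}"
      using rotation_last_argmax[OF a] by simp
    also have "\<dots> = W.prob {x. ?P x}"
      using a by (intro prob_reindex inj_rotation) auto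
    also have "\<dots> = (\<Sum>j\<in>{n - a<..n}. f j * u (n - j))"
      using a by (intro ladder_not_before) auto
    finally show "W.prob {x. 0 \<le> psum x n \<and> last_argmax x n a} = (\<Sum>j\<in>{n - a<..n}. f j * u (n - j))" .
  qed simp
  also have "\<dots> = (\<Sum>a=1..n. \<Sum>j=1..n. if n - a < j then f j * u (n - j) else 0)"
    by (intro sum.cong refl sum.mono_neutral_cong_left) auto
  also have "\<dots> = (\<Sum>j=1..n. \<Sum>a=1..n. if n - a < j then f j * u (n - j) else 0)"
    by (rule sum.swap)
  also have "\<dots> = (\<Sum>j=1..n. real j * f j * u (n - j))"
  proof (rule sum.cong)
    fix j assume j: "j \<in> {1..n}"
    have "(\<Sum>a=1..n. if n - a < j then f j * u (n - j) else 0) = (\<Sum>a\<in>{n - j<..n}. f j * u (n - j))"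
      using j by (intro sum.mono_neutral_cong_right) auto
    also have "\<dots> = real j * f j * u (n - j)" using j by simp
    finally show "(\<Sum>a=1..n. if n - a < j then f j * u (n - j) else 0) = real j * f j * u (n - j)" .
  qed simp
  finally show ?thesis .
qed

text \<open>The generating function identity is obtained from the two renewal equations: with
  \<open>Q\<close> the derivative of the exponent and \<open>F\<close> the generating function of the first ladder
  epoch they say that \<open>Q (1 - F) = F'\<close>.\<close>

lemma fps_conv_radius_bounded:
  fixes c :: "nat \<Rightarrow> real"
  assumes "\<And>n. \<bar>c n\<bar> \<le> 1"
  shows "1 \<le> fps_conv_radius (Abs_fps c)"
  unfolding fps_conv_radius_def fps_nth_Abs_fps
proof (rule conv_radius_geI_ex)
  fix r :: real assume r: "0 < r" "ereal r < 1"
  have "summable (\<lambda>n. c n * r ^ n)"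
  proof (rule summable_comparison_test')
    show "summable (\<lambda>n. r ^ n)" using r by (simp add: one_ereal_def)
    show "norm (c n * r ^ n) \<le> r ^ n" for n
      using mult_right_mono[OF assms, of "r ^ n" n] r by (simp add: abs_mult)
  qed
  then show "\<exists>z. norm z = r \<and> summable (\<lambda>n. c n * z ^ n)" using r by (intro exI[of _ r]) auto
qed

definition expo :: "real \<Rightarrow> real" where
  "expo y = eval_fps (Abs_fps (\<lambda>n. if n = 0 then 0 else p n / real n)) y"

definition gen :: "real \<Rightarrow> real" where "gen y = eval_fps (Abs_fps f) y"

lemma f_0 [simp]: "f 0 = 0"
  by (simp add: f_def first_passage_def)

lemma p_bounds: "0 \<le> p n" "p n \<le> 1" by (simp_all add: p_def)
lemma f_bounds: "0 \<le> f n" "f n \<le> 1" by (simp_all add: f_def)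

lemma expo_sums:
  assumes "\<bar>y\<bar> < 1"
  shows "(\<lambda>n. y ^ Suc n / real (Suc n) * p (Suc n)) sums expo y"
proof -
  let ?c = "\<lambda>n. if n = 0 then 0 else p n / real n"
  have "p n \<le> real n" if "n \<noteq> 0" for n using p_bounds(2)[of n] that by linarith
  then have "1 \<le> fps_conv_radius (Abs_fps ?c)"
    using p_bounds by (intro fps_conv_radius_bounded) (simp add: abs_mult)
  moreover have "ereal (norm y) < 1" using assms by simp
  ultimately have "ereal (norm y) < fps_conv_radius (Abs_fps ?c)" by (rule less_le_trans[rotated])
  then have "(\<lambda>n. ?c n * y ^ n) sums expo y"
    using sums_eval_fps[of y "Abs_fps ?c"] by (simp add: expo_def)
  then have "(\<lambda>n. ?c (Suc n) * y ^ Suc n) sums expo y"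
    by (subst sums_Suc_iff) simp
  then show ?thesis by (simp add: mult_ac)
qed

lemma gen_sums:
  assumes "\<bar>y\<bar> < 1" shows "(\<lambda>n. f n * y ^ n) sums gen y"
proof -
  have "1 \<le> fps_conv_radius (Abs_fps f)"
    using f_bounds by (intro fps_conv_radius_bounded) simp
  moreover have "ereal (norm y) < 1" using assms by simp
  ultimately have "ereal (norm y) < fps_conv_radius (Abs_fps f)" by (rule less_le_trans[rotated])
  then show ?thesis
    using sums_eval_fps[of y "Abs_fps f"] by (simp add: gen_def)
qed

theorem sparre_andersen:
  assumes y: "\<bar>y\<bar> < 1"
  shows "1 - gen y = exp (- expo y)"
proof -
  define F where "F = Abs_fps f"
  define U where "U = Abs_fps u"
  define A where "A = Abs_fps (\<lambda>n. if n = 0 then 0 else p n / real n)"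
  have u0: "u 0 = 1" by (simp add: u_def ladder_def W.prob_space[simplified])
  have U: "U = 1 + F * U"
  proof (rule fps_ext)
    fix n show "fps_nth U n = fps_nth (1 + F * U) n"
    proof (cases n)
      case (Suc k)
      have "fps_nth (1 + F * U) n = (\<Sum>j=0..n. f j * u (n - j))"
        using Suc by (simp add: U_def F_def fps_mult_nth)
      also have "\<dots> = (\<Sum>j=1..n. f j * u (n - j))"
        by (subst sum.atLeast_Suc_atMost) auto
      finally show ?thesis using u_renewal[of n] Suc by (simp add: U_def)
    qed (simp add: U_def F_def u0)
  qed
  \<comment> \<open>The factor \<open>fps_X\<close> puts the coefficients \<open>p n\<close> and
    \<open>j * f j\<close> at their own index and makes the constant terms vanish, as needed because
    the renewal equations start at n = 1.\<close>
  have P: "fps_X * fps_deriv A = fps_X * fps_deriv F * U"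
  proof (rule fps_ext)
    fix n show "fps_nth (fps_X * fps_deriv A) n = fps_nth (fps_X * fps_deriv F * U) n"
    proof (cases n)
      case (Suc k)
      have "fps_nth (fps_X * fps_deriv F * U) n = (\<Sum>j=0..n. fps_nth (fps_X * fps_deriv F) j * u (n - j))"
        by (simp add: fps_mult_nth U_def)
      also have "\<dots> = (\<Sum>j=1..n. real j * f j * u (n - j))"
        by (subst sum.atLeast_Suc_atMost) (auto simp: F_def intro!: sum.cong)
      also have "\<dots> = p n" using p_renewal[of n] Suc by simp
      finally show ?thesis using Suc by (simp add: A_def)
    qed (simp add: F_def)
  qed
  have "U * (1 - F) = 1" using U by (simp add: algebra_simps)
  then have "fps_X * fps_deriv A * (1 - F) = fps_X * fps_deriv F"
    by (simp add: P mult.assoc)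
  then have eq: "fps_deriv A * (1 - F) = fps_deriv F"
    by (simp add: mult.assoc)
  have rF: "1 \<le> fps_conv_radius F"
    unfolding F_def using f_bounds by (intro fps_conv_radius_bounded) simp
  have "p n \<le> real n" if "n \<noteq> 0" for n using p_bounds(2)[of n] that by linarith
  then have rA: "1 \<le> fps_conv_radius A"
    unfolding A_def using p_bounds by (intro fps_conv_radius_bounded) (simp add: abs_mult)
  \<comment> \<open>The derivative of this function is exp A (A' (1 - F) - F'), which is zero by
    \<open>eq\<close>; its value at 0 is 1. This replaces taking a logarithm of 1 - F.\<close>
  let ?h = "\<lambda>y. exp (expo y) * (1 - gen y)"
  have D: "(?h has_field_derivative 0) (at y within {-1<..<1})" if "y \<in> {-1<..<1}" for y
  proof -
    have y: "ereal (norm y) < 1" using that by auto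
    have "1 \<le> fps_conv_radius (1 - F)"
      using rF fps_conv_radius_diff[of 1 F] by (auto intro: order_trans)
    with y rF rA have yF: "ereal (norm y) < fps_conv_radius F"
      and yA: "ereal (norm y) < fps_conv_radius A"
      and y1: "ereal (norm y) < fps_conv_radius (1 - F)"
      by (blast intro: less_le_trans)+
    have yA': "ereal (norm y) < fps_conv_radius (fps_deriv A)"
      using yA fps_conv_radius_deriv[of A] by (rule less_le_trans)
    have "(?h has_field_derivative
       exp (expo y) * (eval_fps (fps_deriv A) y * (1 - gen y) - eval_fps (fps_deriv F) y)) (at y within {-1<..<1})"
      unfolding expo_def gen_def F_def[symmetric] A_def[symmetric]
      by (auto intro!: derivative_eq_intros has_field_derivative_eval_fps yF yA simp: algebra_simps)
    also have "eval_fps (fps_deriv A) y * (1 - gen y) = eval_fps (fps_deriv A * (1 - F)) y"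
      using eval_fps_mult[OF yA' y1] eval_fps_diff[of y 1 F] yF by (simp add: gen_def F_def)
    finally show ?thesis by (simp add: eq)
  qed
  have "\<exists>c. \<forall>y\<in>{-1<..<1}. ?h y = c"
    using D by (intro has_field_derivative_zero_constant) auto
  then obtain c where c: "\<And>y. y \<in> {-1<..<1} \<Longrightarrow> ?h y = c" by blast
  have "c = 1" using c[of 0] by (simp add: expo_def gen_def eval_fps_at_0)
  moreover have "y \<in> {-1<..<1}" using y by (simp add: abs_less_iff)
  ultimately have "exp (expo y) * (1 - gen y) = 1" using c by metis
  then show ?thesis by (simp add: exp_minus field_simps)
qed

end

section \<open>The renewal structure of the weak records\<close>

definition tau :: "(nat \<Rightarrow> real) \<Rightarrow> nat" where
  "tau x = (LEAST j. first_passage x j)"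

definition theta :: "(nat \<Rightarrow> real) \<Rightarrow> nat \<Rightarrow> real" where
  "theta x = shift (tau x) x"

definition ladder_epoch :: "nat \<Rightarrow> (nat \<Rightarrow> real) \<Rightarrow> nat" where
  "ladder_epoch m x = (\<Sum>i<m. tau ((theta ^^ i) x))"

definition records :: "(nat \<Rightarrow> real) \<Rightarrow> nat \<Rightarrow> nat" where
  "records x n = card {k\<in>{..n}. ladder x k}"

text \<open>The good event of the deterministic arguments. Asking for a first passage from every
  starting index makes it invariant under \<open>shift\<close>, hence under \<open>theta\<close>, so
  that all epochs are genuine at once; elsewhere \<open>tau\<close> may be a meaningless
  \<open>LEAST\<close>.\<close>

definition ever_passing :: "(nat \<Rightarrow> real) \<Rightarrow> bool" where
  "ever_passing x \<longleftrightarrow> (\<forall>j. \<exists>i. first_passage (shift j x) i)"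

lemma shift_0 [simp]: "shift 0 x = x" by (simp add: shift_def)

lemma ever_passing_shift: "ever_passing x \<Longrightarrow> ever_passing (shift j x)"
  by (simp add: ever_passing_def shift_shift)

lemma ever_passing_theta: "ever_passing x \<Longrightarrow> ever_passing (theta x)"
  by (simp add: theta_def ever_passing_shift)

lemma tau_eq: "first_passage x j \<Longrightarrow> tau x = j"
  unfolding tau_def by (metis LeastI first_passage_unique)

lemma first_passage_tau: "ever_passing x \<Longrightarrow> first_passage x (tau x)"
  unfolding ever_passing_def by (metis tau_eq shift_0)

lemma tau_ge_1: "ever_passing x \<Longrightarrow> 1 \<le> tau x"
  using first_passage_tau by (auto simp: first_passage_def)

lemma theta_funpow: "(theta ^^ m) x = shift (ladder_epoch m x) x"
proof (induction m)
  case (Suc m)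
  have "(theta ^^ Suc m) x = shift (tau ((theta ^^ m) x)) ((theta ^^ m) x)"
    by (simp add: theta_def)
  also have "\<dots> = shift (tau ((theta ^^ m) x)) (shift (ladder_epoch m x) x)"
    by (subst (2) Suc) simp
  finally show ?case by (simp add: shift_shift ladder_epoch_def)
qed (simp add: ladder_epoch_def)

lemma ever_passing_theta_funpow: "ever_passing x \<Longrightarrow> ever_passing ((theta ^^ m) x)"
  by (simp add: theta_funpow ever_passing_shift)

lemma ladder_epoch_0 [simp]: "ladder_epoch 0 x = 0"
  by (simp add: ladder_epoch_def)

lemma ladder_epoch_add: "ladder_epoch (m + k) x = ladder_epoch m x + ladder_epoch k ((theta ^^ m) x)"
proof (induction k)
  case (Suc k)
  have "(theta ^^ (m + k)) x = (theta ^^ k) ((theta ^^ m) x)"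
    by (metis add.commute comp_apply funpow_add)
  with Suc show ?case by (simp add: ladder_epoch_def)
qed (simp add: ladder_epoch_def)

lemma ladder_epoch_1 [simp]: "ladder_epoch (Suc 0) x = tau x"
  by (simp add: ladder_epoch_def)

lemma ladder_epoch_Suc: "ladder_epoch (Suc m) x = tau x + ladder_epoch m (theta x)"
  using ladder_epoch_add[of "Suc 0" m x] by simp

lemma strict_mono_ladder_epoch: "ever_passing x \<Longrightarrow> strict_mono (\<lambda>m. ladder_epoch m x)"
  using tau_ge_1[OF ever_passing_theta_funpow[of x]]
  by (intro strict_monoI_Suc) (simp add: ladder_epoch_def Suc_le_eq)

text \<open>Both directions peel off the first epoch with \<open>ladder_first_passage\<close> and
  continue with the sequence \<open>theta x\<close>.\<close>

lemma ladder_iff_epoch: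
  assumes "ever_passing x" shows "ladder x n \<longleftrightarrow> (\<exists>m. n = ladder_epoch m x)"
proof
  show "ladder x n \<Longrightarrow> \<exists>m. n = ladder_epoch m x" using assms
  proof (induction n arbitrary: x rule: less_induct)
    case (less n)
    show ?case
    proof (cases "n = 0")
      case True
      then show ?thesis by (intro exI[of _ 0]) simp
    next
      case False
      then obtain j where j: "j \<in> {1..n}" "first_passage x j"
        using nonneg_first_passage[of n x] ladder_imp_nonneg[OF less.prems(1)] by auto
      then have "ladder (theta x) (n - j)"
        using ladder_first_passage[of x j n] less.prems tau_eq[of x j] by (simp add: theta_def)
      then obtain m where "n - j = ladder_epoch m (theta x)"
        using less.IH[of "n - j" "theta x"] j ever_passing_theta[OF less.prems(2)] by auto
      then have "n = ladder_epoch (Suc m) x"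
        using j tau_eq[of x j] unfolding ladder_epoch_Suc by auto
      then show ?thesis ..
    qed
  qed
next
  have "ladder x (ladder_epoch m x)" for m
    using assms
  proof (induction m arbitrary: x)
    case (Suc m)
    then show ?case
      using ladder_first_passage[OF first_passage_tau[of x], of "ladder_epoch (Suc m) x"]
        ever_passing_theta[of x]
      by (simp add: ladder_epoch_Suc theta_def)
  qed (simp add: ladder_def)
  then show "\<exists>m. n = ladder_epoch m x \<Longrightarrow> ladder x n" by blast
qed

text \<open>The inequality on the left is strict because \<open>ladder_epoch 0 x\<close> is 0: step
  0 already counts as a record.\<close>

lemma less_records_iff:
  assumes "ever_passing x" shows "m < records x n \<longleftrightarrow> ladder_epoch m x \<le> n"
proof -
  note mono = strict_mono_ladder_epoch[OF assms]
  have inj: "inj_on (\<lambda>m. ladder_epoch m x) A" for A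
    using mono by (meson inj_on_subset strict_mono_imp_inj_on subset_UNIV)
  have eq: "{k\<in>{..n}. ladder x k} = (\<lambda>m. ladder_epoch m x) ` {m. ladder_epoch m x \<le> n}"
    using ladder_iff_epoch[OF assms] by auto
  show ?thesis
  proof
    assume "ladder_epoch m x \<le> n"
    then have "ladder_epoch i x \<le> n" if "i \<le> m" for i
      using strict_mono_less_eq[OF mono, of i m] that by linarith
    then have "(\<lambda>m. ladder_epoch m x) ` {..m} \<subseteq> {k\<in>{..n}. ladder x k}"
      unfolding eq by auto
    then have "card ((\<lambda>m. ladder_epoch m x) ` {..m}) \<le> records x n"
      unfolding records_def by (intro card_mono) auto
    then show "m < records x n" by (simp add: card_image[OF inj])
  next
    assume *: "m < records x n"
    show "ladder_epoch m x \<le> n"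
    proof (rule ccontr)
      assume "\<not> ?thesis"
      then have "i < m" if "ladder_epoch i x \<le> n" for i
        using strict_mono_less[OF mono, of i m] that by linarith
      then have "{k\<in>{..n}. ladder x k} \<subseteq> (\<lambda>m. ladder_epoch m x) ` {..<m}"
        unfolding eq by auto
      then have "records x n \<le> card ((\<lambda>m. ladder_epoch m x) ` {..<m})"
        unfolding records_def by (intro card_mono) auto
      then show False using * by (simp add: card_image[OF inj])
    qed
  qed
qed

text \<open>For sequences that keep passing this says \<open>ladder_epoch m x = j\<close>, but unlike that equation it
  depends on the first \<open>j\<close> steps only.\<close>
definition epoch_at :: "nat \<Rightarrow> nat \<Rightarrow> (nat \<Rightarrow> real) \<Rightarrow> bool" where
  "epoch_at m j x \<longleftrightarrow> ladder x j \<and> records x j = Suc m"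

lemma epoch_at_iff: "ever_passing x \<Longrightarrow> epoch_at m j x \<longleftrightarrow> ladder_epoch m x = j"
proof -
  assume x: "ever_passing x"
  have rec: "records x (ladder_epoch k x) = Suc k" for k
    using less_records_iff[OF x, of k "ladder_epoch k x"] less_records_iff[OF x, of "Suc k" "ladder_epoch k x"]
      strict_mono_less_eq[OF strict_mono_ladder_epoch[OF x], of "Suc k" k] by simp
  show ?thesis
    unfolding epoch_at_def using ladder_iff_epoch[OF x, of j] rec by (metis nat.inject)
qed

text \<open>Valid without \<open>ever_passing\<close>, since a later record always raises the count;
  this makes the events in \<open>strong_markov\<close> disjoint for all sequences.\<close>

lemma epoch_at_unique:
  assumes "epoch_at m i x" "epoch_at m j x" shows "i = j"
proof -
  have False if "i < j" "epoch_at m i x" "epoch_at m j x" for i j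
  proof -
    have "insert j {k\<in>{..i}. ladder x k} \<subseteq> {k\<in>{..j}. ladder x k}"
      using that by (auto simp: epoch_at_def)
    then have "card (insert j {k\<in>{..i}. ladder x k}) \<le> records x j"
      unfolding records_def by (intro card_mono) auto
    then show False using that by (simp add: epoch_at_def records_def)
  qed
  then show ?thesis using assms by (meson linorder_neqE_nat)
qed

lemma epoch_at_cong:
  assumes "\<And>i. i < j \<Longrightarrow> x i = y i" shows "epoch_at m j x = epoch_at m j y"
proof -
  have "psum x k = psum y k" if "k \<le> j" for k
    using that assms by (intro psum_cong) simp
  then have "ladder x k = ladder y k" if "k \<le> j" for k
    using that by (simp add: ladder_def)
  then have "{k\<in>{..j}. ladder x k} = {k\<in>{..j}. ladder y k}" "ladder x j = ladder y j" by auto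
  then show ?thesis by (simp add: epoch_at_def records_def)
qed

definition height :: "(nat \<Rightarrow> real) \<Rightarrow> real" where "height x = psum x (tau x)"

lemma height_nonneg: "ever_passing x \<Longrightarrow> 0 \<le> height x"
  using first_passage_tau by (simp add: height_def first_passage_def)

lemma psum_ladder_epoch: "psum x (ladder_epoch m x) = (\<Sum>i<m. height ((theta ^^ i) x))"
  by (induction m) (simp_all add: ladder_epoch_add[of _ "Suc 0", simplified] psum_add theta_funpow height_def)

lemma measurable_tau [measurable]: "tau \<in> measurable seq_borel (count_space UNIV)"
  unfolding tau_def by measurable

lemma measurable_theta [measurable]: "theta \<in> measurable seq_borel seq_borel"
  unfolding theta_def by (rule measurable_compose_countable[OF measurable_shift measurable_tau])

lemma measurable_theta_funpow [measurable]: "(theta ^^ m) \<in> measurable seq_borel seq_borel"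
  by (induction m) (simp_all add: measurable_comp[OF _ measurable_theta] id_def)

lemma measurable_ladder_epoch [measurable]: "ladder_epoch m \<in> measurable seq_borel (count_space UNIV)"
  unfolding ladder_epoch_def[abs_def]
  by (intro measurable_sum_nat measurable_compose[OF measurable_theta_funpow measurable_tau])

lemma measurable_height [measurable]: "height \<in> borel_measurable seq_borel"
  unfolding height_def by (rule measurable_compose_countable[OF measurable_psum measurable_tau])

lemma measurable_records [measurable]: "(\<lambda>x. records x n) \<in> measurable seq_borel (count_space UNIV)"
proof -
  have "records x n = (\<Sum>k\<le>n. if ladder x k then 1 else 0)" for x
    unfolding records_def by (subst card_eq_sum, subst sum.inter_filter[symmetric]) auto
  then show ?thesis by simp
qed

lemma measurable_epoch_at [measurable]: "Measurable.pred seq_borel (epoch_at m j)"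
  unfolding epoch_at_def[abs_def] by measurable

section \<open>Finiteness and independence of the ladder epochs\<close>

locale proper_walk = random_walk +
  assumes expo_top: "filterlim expo at_top (at_left 1)"
begin

text \<open>The total mass of \<open>f\<close> is at least \<open>gen y\<close> for every y in
  (0,1), and by the Sparre Andersen identity \<open>gen y\<close> tends to 1 as y increases to
  1.\<close>

lemma AE_first_passage: "AE x in W. \<exists>j. first_passage x j"
proof -
  let ?E = "\<Union>j. {x. first_passage x j}"
  have E: "f sums W.prob ?E"
    unfolding f_def
    by (intro W.finite_measure_UNION)
      (auto simp: disjoint_family_on_def intro!: sets_Collect_W dest: first_passage_unique)
  have "1 - exp (- expo y) \<le> W.prob ?E" if "y \<in> {0<..<1}" for y
  proof -
    have "gen y \<le> W.prob ?E"
    proof (rule sums_le[OF _ gen_sums E])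
      show "f n * y ^ n \<le> f n" for n
        using f_bounds[of n] that by (simp add: mult_left_le power_le_one)
    qed (use that in simp)
    then show ?thesis using sparre_andersen[of y] that by simp
  qed
  then have ev: "\<forall>\<^sub>F y in at_left 1. 1 - exp (- expo y) \<le> W.prob ?E"
    using eventually_at_left_real[of 0 1] by (auto elim!: eventually_mono)
  have "((\<lambda>y. 1 - exp (- expo y)) \<longlongrightarrow> 1 - 0) (at_left 1)"
    using expo_top by (intro tendsto_intros filterlim_compose[OF exp_at_bot])
      (simp add: filterlim_uminus_at_bot)
  then have "1 \<le> W.prob ?E"
    using tendsto_upperbound[OF _ ev] by simp
  then have "W.prob ?E = 1" by (simp add: antisym)
  moreover have "?E \<in> sets W" by (intro sets.countable_UN) (auto intro!: sets_Collect_W)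
  ultimately have "AE x in W. x \<in> ?E" by (simp add: W.prob_eq_1)
  then show ?thesis by simp
qed

lemma AE_ever_passing: "AE x in W. ever_passing x"
proof -
  have "AE x in W. \<exists>i. first_passage (shift j x) i" for j
  proof -
    have "W.prob {x. \<exists>i. first_passage (shift j x) i} = W.prob {x. \<exists>i. first_passage x i}"
      by (rule prob_shift) measurable
    moreover have "W.prob {x. \<exists>i. first_passage x i} = 1"
      using AE_first_passage by (subst prob_one_iff) simp_all
    ultimately have "W.prob {x. \<exists>i. first_passage (shift j x) i} = 1" by simp
    then show ?thesis by (subst (asm) prob_one_iff) simp_all
  qed
  then show ?thesis unfolding ever_passing_def by (simp add: AE_all_countable)
qed

text \<open>Splitting by the value \<open>j\<close> of the epoch reduces the claim to
  \<open>markov\<close>, because \<open>epoch_at m j\<close> is decided by the first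
  \<open>j\<close> steps.\<close>

lemma strong_markov:
  assumes [measurable]: "\<And>j. Measurable.pred W (P j)" "Measurable.pred W Q"
    and dep: "\<And>j x y. (\<And>i. i < j \<Longrightarrow> x i = y i) \<Longrightarrow> P j x = P j y"
  shows "W.prob {x. P (ladder_epoch m x) x \<and> Q ((theta ^^ m) x)} =
    W.prob {x. P (ladder_epoch m x) x} * W.prob {x. Q x}"
proof -
  \<comment> \<open>With \<open>R = Q\<close> this evaluates the left side, with \<open>R\<close>
    always true the first factor on the right; comparing the two series gives the product.\<close>
  have main: "(\<lambda>j. W.prob {x. epoch_at m j x \<and> P j x} * W.prob {x. R x}) sums
      W.prob {x. P (ladder_epoch m x) x \<and> R ((theta ^^ m) x)}"
    if R [measurable]: "Measurable.pred W R" for R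
  proof -
    let ?A = "\<lambda>j. {x. (epoch_at m j x \<and> P j x) \<and> R (shift j x)}"
    have A: "?A j \<in> sets W" for j by (intro sets_Collect_W) measurable
    have "(\<lambda>j. W.prob (?A j)) sums W.prob (\<Union>j. ?A j)"
      using A by (intro W.finite_measure_UNION) (auto simp: disjoint_family_on_def dest: epoch_at_unique)
    moreover have "W.prob (?A j) = W.prob {x. epoch_at m j x \<and> P j x} * W.prob {x. R x}" for j
    proof (rule markov)
      fix x y :: "nat \<Rightarrow> real" assume eq: "\<And>i. i < j \<Longrightarrow> x i = y i"
      have "P j x = P j y" by (rule dep) (rule eq)
      moreover have "epoch_at m j x = epoch_at m j y" by (rule epoch_at_cong) (rule eq)
      ultimately show "(epoch_at m j x \<and> P j x) = (epoch_at m j y \<and> P j y)" by simp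
    qed measurable
    ultimately have "(\<lambda>j. W.prob {x. epoch_at m j x \<and> P j x} * W.prob {x. R x}) sums W.prob (\<Union>j. ?A j)"
      by simp
    moreover have "W.prob {x. P (ladder_epoch m x) x \<and> R ((theta ^^ m) x)} = W.prob (\<Union>j. ?A j)"
    proof (rule W.finite_measure_eq_AE)
      show "AE x in W. x \<in> {x. P (ladder_epoch m x) x \<and> R ((theta ^^ m) x)} \<longleftrightarrow> x \<in> (\<Union>j. ?A j)"
        using AE_ever_passing by eventually_elim (auto simp: epoch_at_iff theta_funpow)
      have "Measurable.pred W (\<lambda>x. P (ladder_epoch m x) x)"
        by (rule measurable_compose_countable[where g = "ladder_epoch m"]) measurable
      then show "{x. P (ladder_epoch m x) x \<and> R ((theta ^^ m) x)} \<in> sets W"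
        by (intro sets_Collect_W) measurable
    qed (use A in auto)
    ultimately show ?thesis by simp
  qed
  show ?thesis
    using sums_unique2[OF main[of Q] sums_mult2[OF main[of "\<lambda>_. True", simplified prob_True mult_1_right]]]
    by simp
qed

lemma strong_markov_epoch:
  assumes "Measurable.pred W Q"
  shows "W.prob {x. P (ladder_epoch m x) \<and> Q ((theta ^^ m) x)} =
    W.prob {x. P (ladder_epoch m x)} * W.prob {x. Q x}"
  using strong_markov[of "\<lambda>j _. P j" Q m] assms by simp

lemma prob_theta_funpow:
  assumes "Measurable.pred W Q"
  shows "W.prob {x. Q ((theta ^^ m) x)} = W.prob {x. Q x}"
  using strong_markov_epoch[OF assms, of "\<lambda>_. True" m] W.prob_space by simp

lemma distr_theta: "distr W W theta = W"
proof (rule measure_eqI)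
  fix A assume "A \<in> sets (distr W W theta)"
  then have A: "Measurable.pred W (\<lambda>x. x \<in> A)" "A \<in> sets W" by auto
  then show "emeasure (distr W W theta) A = emeasure W A"
    using prob_theta_funpow[OF A(1), of 1]
    by (simp add: emeasure_distr W.emeasure_eq_measure vimage_def)
qed simp

lemma integral_tau:
  assumes "0 \<le> y" "y < 1"
  shows "(\<integral>x. y ^ tau x \<partial>W) = gen y"
proof -
  let ?g = "\<lambda>n x. indicator {x. first_passage x n} x * y ^ n"
  have [measurable]: "{x. first_passage x n} \<in> sets W" for n by (intro sets_Collect_W) measurable
  have int: "integrable W (?g n)" for n by (rule W.integrable_const_bound[where B = 1])
      (use assms in \<open>auto simp: power_le_one indicator_def\<close>)
  have eq: "(\<integral>x. ?g n x \<partial>W) = f n * y ^ n" for n by (simp add: f_def)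
  have single: "(\<lambda>n. ?g n x) sums y ^ tau x" if "ever_passing x" for x
  proof -
    have "first_passage x n \<longleftrightarrow> n = tau x" for n
      using first_passage_tau[OF that] tau_eq by metis
    then have "(\<lambda>n. if n = tau x then y ^ n else 0) = (\<lambda>n. ?g n x)"
      by (simp add: indicator_def fun_eq_iff)
    then show ?thesis using sums_single[of "tau x" "\<lambda>n. y ^ n"] by simp
  qed
  have nonneg: "norm (?g n x) = ?g n x" for n x using assms by simp
  have "(\<lambda>n. \<integral>x. ?g n x \<partial>W) sums (\<integral>x. (\<Sum>n. ?g n x) \<partial>W)"
  proof (rule sums_integral[OF int])
    show "AE x in W. summable (\<lambda>n. norm (?g n x))"
      unfolding nonneg using AE_ever_passing by eventually_elim (auto dest: single sums_summable)
    show "summable (\<lambda>n. \<integral>x. norm (?g n x) \<partial>W)"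
      unfolding nonneg eq using gen_sums[of y] assms by (simp add: sums_iff)
  qed
  moreover have "(\<integral>x. (\<Sum>n. ?g n x) \<partial>W) = (\<integral>x. y ^ tau x \<partial>W)"
  proof (rule integral_cong_AE)
    show "AE x in W. (\<Sum>n. ?g n x) = y ^ tau x"
      using AE_ever_passing by eventually_elim (simp add: sums_unique[OF single])
  qed measurable
  ultimately show ?thesis
    unfolding eq using gen_sums[of y] assms by (simp add: sums_iff)
qed

lemma laplace_ladder_epoch:
  assumes "0 \<le> y" "y < 1"
  shows "(\<integral>x. y ^ ladder_epoch m x \<partial>W) = gen y ^ m"
proof (induction m)
  case (Suc m)
  let ?X = "\<lambda>x. y ^ tau x" and ?Y = "\<lambda>x. y ^ ladder_epoch m (theta x)"
  have [measurable]: "?X \<in> borel_measurable W" "?Y \<in> borel_measurable W" by measurable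
  have bound: "norm (y ^ k) \<le> 1" for k using assms by (simp add: power_le_one)
  have int: "integrable W ?X" "integrable W ?Y"
    by (rule W.integrable_const_bound[where B = 1]; use bound in simp)+
  \<comment> \<open>The preimages of Borel sets already form a sigma-algebra, so the product rule
    has to be checked for pairs of preimages only, where it is \<open>strong_markov_epoch\<close> at
    the first epoch.\<close>
  have "W.indep_var borel ?X borel ?Y"
    unfolding W.indep_var_eq
  proof (intro conjI)
    have eq: "sigma_sets (space W) {Z -` A \<inter> space W |A. A \<in> sets borel} = {Z -` A \<inter> space W |A. A \<in> sets borel}"
      if "Z \<in> borel_measurable W" for Z :: "_ \<Rightarrow> real"
      using sets_vimage_algebra[of "space W" Z borel] sets_vimage_algebra2[of Z "space W" borel] that
      by (simp add: measurable_def)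
    show "W.indep_set (sigma_sets (space W) {?X -` A \<inter> space W |A. A \<in> sets borel})
       (sigma_sets (space W) {?Y -` A \<inter> space W |A. A \<in> sets borel})"
      unfolding eq[OF \<open>?X \<in> borel_measurable W\<close>] eq[OF \<open>?Y \<in> borel_measurable W\<close>]
    proof (rule W.indep_setI)
      fix a b assume "a \<in> {?X -` A \<inter> space W |A. A \<in> sets borel}" "b \<in> {?Y -` A \<inter> space W |A. A \<in> sets borel}"
      then obtain A B where AB: "A \<in> sets borel" "B \<in> sets borel" "a = {x. ?X x \<in> A}" "b = {x. ?Y x \<in> B}"
        by auto
      have Q: "Measurable.pred W (\<lambda>x. y ^ ladder_epoch m x \<in> B)" using AB(2) by measurable
      have "a \<inter> b = {x. y ^ ladder_epoch 1 x \<in> A \<and> y ^ ladder_epoch m ((theta ^^ 1) x) \<in> B}"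
        by (auto simp: AB)
      also have "W.prob \<dots> = W.prob a * W.prob {x. y ^ ladder_epoch m x \<in> B}"
        by (subst strong_markov_epoch[OF Q, of "\<lambda>j. y ^ j \<in> A" 1]) (simp add: AB)
      also have "W.prob {x. y ^ ladder_epoch m x \<in> B} = W.prob b"
        using prob_theta_funpow[OF Q, of 1] by (simp add: AB)
      finally show "W.prob (a \<inter> b) = W.prob a * W.prob b" .
    next
      have vimage: "Z -` A \<in> sets W" if "Z \<in> borel_measurable W" "A \<in> sets borel" for Z :: "_ \<Rightarrow> real" and A
        using measurable_sets[OF that] by simp
      show "{?X -` A \<inter> space W |A. A \<in> sets borel} \<subseteq> sets W" "{?Y -` A \<inter> space W |A. A \<in> sets borel} \<subseteq> sets W"
        using vimage[OF \<open>?X \<in> borel_measurable W\<close>] vimage[OF \<open>?Y \<in> borel_measurable W\<close>] by auto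
    qed
  qed measurable
  then have "(\<integral>x. ?X x * ?Y x \<partial>W) = (\<integral>x. ?X x \<partial>W) * (\<integral>x. ?Y x \<partial>W)"
    by (rule W.indep_var_lebesgue_integral) (fact int)+
  also have "(\<integral>x. ?Y x \<partial>W) = (\<integral>x. y ^ ladder_epoch m x \<partial>distr W W theta)"
    by (subst integral_distr) auto
  also have "\<dots> = gen y ^ m" unfolding distr_theta by (rule Suc)
  finally show ?case by (simp add: ladder_epoch_Suc power_add integral_tau[OF assms])
qed (simp add: W.prob_space[simplified])

text \<open>Successive blocks of \<open>m 0\<close>, \<open>m 1\<close>, ... epochs have independent
  durations. The induction removes the first block, hence the generalisation over \<open>m\<close>
  and \<open>P\<close>.\<close>

lemma prob_blocks:
  fixes N :: nat
  shows "W.prob {x. \<forall>k<N. P k (ladder_epoch (m k) ((theta ^^ (\<Sum>j<k. m j)) x))} =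
    (\<Prod>k<N. W.prob {x. P k (ladder_epoch (m k) x)})"
proof (induction N arbitrary: m P)
  case 0
  then show ?case using W.prob_space by simp
next
  case (Suc N)
  let ?Q = "\<lambda>x. \<forall>k<N. P (Suc k) (ladder_epoch (m (Suc k)) ((theta ^^ (\<Sum>j<k. m (Suc j))) x))"
  have split: "(theta ^^ (\<Sum>j<Suc k. m j)) x = (theta ^^ (\<Sum>j<k. m (Suc j))) ((theta ^^ m 0) x)" for k x
    unfolding sum.lessThan_Suc_shift by (metis add.commute comp_apply funpow_add)
  have set: "{x. \<forall>k<Suc N. P k (ladder_epoch (m k) ((theta ^^ (\<Sum>j<k. m j)) x))} =
      {x. P 0 (ladder_epoch (m 0) x) \<and> ?Q ((theta ^^ m 0) x)}"
    unfolding All_less_Suc2 split by simp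
  have Q: "Measurable.pred W ?Q"
  proof -
    have epoch: "(\<lambda>x. ladder_epoch c ((theta ^^ s) x)) \<in> measurable W (count_space UNIV)" for c s
      by measurable
    have "Measurable.pred W (\<lambda>x. R (ladder_epoch c ((theta ^^ s) x)))" for R c s
      by (rule measurable_compose[OF epoch]) simp
    then show ?thesis by (intro pred_intros_countable pred_intros_imp')
  qed
  show ?case
    unfolding set strong_markov_epoch[OF Q] Suc[of "\<lambda>k. P (Suc k)" "\<lambda>k. m (Suc k)"]
      prod.lessThan_Suc_shift comp_def ..
qed

text \<open>Ladder heights are nonnegative and independent, and a first step above \<epsilon> is
  itself the first height. So, almost surely, after every epoch there is a further height above
  \<epsilon>, and the sums at the epochs diverge.\<close>

lemma AE_walk_unbounded_above:
  assumes pos: "0 < W.prob {x. \<epsilon> < x 0}" and eps: "0 < \<epsilon>"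
  shows "AE x in W. \<forall>b. \<exists>n. b \<le> psum x n"
proof -
  define q where "q = W.prob {x. height x \<le> \<epsilon>}"
  have [measurable]: "Measurable.pred W (\<lambda>x. height x \<le> \<epsilon>)" by measurable
  have [measurable]: "Measurable.pred W (\<lambda>x. \<epsilon> < x 0)" by measurable
  have "q < 1"
  proof -
    have "AE x in W. height x \<le> \<epsilon> \<longrightarrow> \<not> \<epsilon> < x 0"
      using AE_ever_passing
    proof eventually_elim
      case (elim x)
      have "height x = x 0" if "\<epsilon> < x 0"
      proof -
        have "first_passage x 1" using that eps by (simp add: first_passage_def psum_def)
        then show ?thesis by (simp add: tau_eq height_def psum_def)
      qed
      then show ?case by auto
    qed
    then have "q \<le> W.prob {x. \<not> \<epsilon> < x 0}"
      unfolding q_def by (intro W.finite_measure_mono_AE sets_Collect_W) auto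
    also have "\<dots> = 1 - W.prob {x. \<epsilon> < x 0}"
      using W.prob_neg[of "\<lambda>x. \<epsilon> < x 0"] sets_Collect_W[of "\<lambda>x. \<epsilon> < x 0"] by simp
    finally show ?thesis using pos by simp
  qed
  have q0: "0 \<le> q" by (simp add: q_def)
  have power: "W.prob {x. \<forall>i<N. height ((theta ^^ i) x) \<le> \<epsilon>} = q ^ N" for N
  proof (induction N)
    case (Suc N)
    \<comment> \<open>The height depends on the path up to the epoch and not on the epoch alone, so
      the path-dependent \<open>P\<close> of \<open>strong_markov\<close> is used here.\<close>
    have "{x. \<forall>i<Suc N. height ((theta ^^ i) x) \<le> \<epsilon>} =
      {x. psum x (ladder_epoch 1 x) \<le> \<epsilon> \<and> (\<forall>i<N. height ((theta ^^ i) ((theta ^^ 1) x)) \<le> \<epsilon>)}"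
      unfolding All_less_Suc2 by (simp add: height_def funpow_swap1)
    also have "W.prob \<dots> = W.prob {x. psum x (ladder_epoch 1 x) \<le> \<epsilon>} * W.prob {x. \<forall>i<N. height ((theta ^^ i) x) \<le> \<epsilon>}"
      by (rule strong_markov) (measurable, simp cong: psum_cong)
    finally show ?case using Suc by (simp add: q_def height_def)
  qed (use W.prob_space in simp)
  have "AE x in W. \<exists>i. \<epsilon> < height ((theta ^^ i) ((theta ^^ K) x))" for K
  proof -
    have "W.prob {x. \<forall>i. height ((theta ^^ i) x) \<le> \<epsilon>} \<le> q ^ N" for N
      unfolding power[symmetric]
      by (rule W.finite_measure_mono) (auto intro!: sets_Collect_W)
    moreover have "(\<lambda>N. q ^ N) \<longlonglongrightarrow> 0" using q0 \<open>q < 1\<close> by (intro LIMSEQ_power_zero) simp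
    ultimately have "W.prob {x. \<forall>i. height ((theta ^^ i) x) \<le> \<epsilon>} \<le> 0"
      by (intro LIMSEQ_le_const) auto
    moreover have "0 \<le> W.prob {x. \<forall>i. height ((theta ^^ i) x) \<le> \<epsilon>}" by simp
    ultimately have "W.prob {x. \<forall>i. height ((theta ^^ i) x) \<le> \<epsilon>} = 0" by linarith
    then have *: "W.prob {x. \<forall>i. height ((theta ^^ i) ((theta ^^ K) x)) \<le> \<epsilon>} = 0"
      using prob_theta_funpow[of "\<lambda>x. \<forall>i. height ((theta ^^ i) x) \<le> \<epsilon>" K] by simp
    have "AE x in W. \<not> (\<forall>i. height ((theta ^^ i) ((theta ^^ K) x)) \<le> \<epsilon>)"
      using * by (subst (asm) prob_zero_iff) simp_all
    then show ?thesis by (simp add: not_le)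
  qed
  then have "AE x in W. \<forall>K. \<exists>i. \<epsilon> < height ((theta ^^ i) ((theta ^^ K) x))"
    by (simp add: AE_all_countable)
  with AE_ever_passing show ?thesis
  proof eventually_elim
    case (elim x)
    have "\<exists>m. real r * \<epsilon> \<le> psum x (ladder_epoch m x)" for r
    proof (induction r)
      case (Suc r)
      then obtain m where m: "real r * \<epsilon> \<le> psum x (ladder_epoch m x)" by blast
      obtain i where i: "\<epsilon> < height ((theta ^^ i) ((theta ^^ m) x))" using elim(2) by blast
      have "(theta ^^ (m + i)) x = (theta ^^ i) ((theta ^^ m) x)"
        by (metis add.commute comp_apply funpow_add)
      then have "psum x (ladder_epoch (m + i) x) + \<epsilon> \<le> psum x (ladder_epoch (Suc (m + i)) x)"
        using i by (simp add: psum_ladder_epoch)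
      moreover have "psum x (ladder_epoch m x) \<le> psum x (ladder_epoch (m + i) x)"
        unfolding psum_ladder_epoch using elim(1)
        by (intro sum_mono2) (auto intro!: height_nonneg ever_passing_theta_funpow)
      ultimately show ?case using m by (intro exI[of _ "Suc (m + i)"]) (simp add: algebra_simps)
    qed (auto intro: exI[of _ 0])
    then show ?case using eps
      by (meson order.trans real_arch_simple[of "b / \<epsilon>" for b] pos_divide_le_eq)
  qed
qed

end

section \<open>Regular variation\<close>

lemma log_series_sums:
  fixes y :: real assumes "0 \<le> y" "y < 1"
  shows "(\<lambda>k. y ^ Suc k / real (Suc k)) sums (- ln (1 - y))"
proof -
  have "summable (\<lambda>k. y ^ Suc k / real (Suc k))"
  proof (rule summable_comparison_test')
    show "summable (\<lambda>k. y ^ k)" using assms by simp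
    show "norm (y ^ Suc k / real (Suc k)) \<le> y ^ k" for k
      using assms mult_mono[of y "real (Suc k)" "y ^ k" "y ^ k"]
      by (simp add: divide_le_eq mult.commute)
  qed
  moreover have "ln (1 - y) = (\<Sum>k. - (y ^ Suc k / real (Suc k)))"
  proof -
    have "(- 1) ^ k * (1 / real (k + 1)) * (1 - y - 1) ^ Suc k = - (y ^ Suc k / real (Suc k))" for k
    proof -
      have "(1 - y - 1) ^ Suc k = (- 1) ^ Suc k * y ^ Suc k" using power_minus[of y "Suc k"] by simp
      moreover have "(- 1) ^ k * (- 1) ^ Suc k = (- 1 :: real)"
        unfolding power_add[symmetric] by simp
      ultimately show ?thesis by (simp only:) (simp add: mult_ac)
    qed
    then show ?thesis using ln_series[of "1 - y"] assms by (simp only:)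
  qed
  ultimately show ?thesis by (simp add: sums_iff suminf_minus)
qed

text \<open>Both cases of the statement in one: for positive \<rho> the divergence is deduced from
  \<open>p_lim\<close> by comparison with the harmonic series when the locale is
  interpreted.\<close>

locale regular_walk = random_walk +
  fixes \<rho> :: real
  assumes rho: "0 \<le> \<rho>" "\<rho> < 1" and p_lim: "p \<longlonglongrightarrow> \<rho>"
    and p_div: "\<not> summable (\<lambda>k. p (Suc k) / real (Suc k))"
begin

text \<open>A finite head of the series is continuous at 1 and can be made large there, while the
  tail is nonnegative.\<close>

lemma expo_top: "filterlim expo at_top (at_left 1)"
  unfolding filterlim_at_top
proof
  fix Z :: real
  let ?a = "\<lambda>k. p (Suc k) / real (Suc k)"
  have "\<exists>K. Z + 1 < (\<Sum>k<K. ?a k)"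
  proof (rule ccontr)
    assume "\<not> ?thesis"
    then have "\<And>K. (\<Sum>k<K. ?a k) \<le> Z + 1" by (meson not_le)
    then have "summable ?a" using p_bounds by (intro bounded_imp_summable[where B = "Z + 1"])
        (auto simp: lessThan_Suc_atMost[symmetric] simp del: sum.lessThan_Suc)
    then show False using p_div by simp
  qed
  then obtain K where K: "Z + 1 < (\<Sum>k<K. ?a k)" ..
  let ?h = "\<lambda>y. \<Sum>k<K. y ^ Suc k / real (Suc k) * p (Suc k)"
  have "(?h \<longlongrightarrow> ?h 1) (at_left 1)" by (intro tendsto_intros) auto
  moreover have "Z < ?h 1" using K by simp
  ultimately have "\<forall>\<^sub>F y in at_left 1. Z < ?h y" by (rule order_tendstoD)
  moreover have "\<forall>\<^sub>F y in at_left 1. y \<in> {0<..<1::real}" by (rule eventually_at_left_real) simp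
  ultimately show "\<forall>\<^sub>F y in at_left 1. Z \<le> expo y"
  proof eventually_elim
    case (elim y)
    then have s: "(\<lambda>n. y ^ Suc n / real (Suc n) * p (Suc n)) sums expo y"
      by (intro expo_sums) simp
    have "?h y \<le> expo y"
      unfolding sums_unique[OF s]
      by (rule sum_le_suminf[OF sums_summable[OF s]]) (use p_bounds elim in auto)
    with elim show ?case by simp
  qed
qed

sublocale proper_walk by unfold_locales (rule expo_top)

lemma expo_mono:
  assumes "0 \<le> y" "y \<le> z" "z < 1" shows "expo y \<le> expo z"
proof (rule sums_le[OF _ expo_sums expo_sums])
  show "y ^ Suc n / real (Suc n) * p (Suc n) \<le> z ^ Suc n / real (Suc n) * p (Suc n)" for n
    using assms p_bounds by (intro mult_right_mono divide_right_mono power_mono) auto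
qed (use assms in auto)

lemma expo_le_log:
  assumes "0 \<le> y" "y < 1" shows "expo y \<le> - ln (1 - y)"
proof (rule sums_le[OF _ expo_sums log_series_sums])
  show "y ^ Suc n / real (Suc n) * p (Suc n) \<le> y ^ Suc n / real (Suc n)" for n
    by (rule mult_left_le) (use assms p_bounds in auto)
qed (use assms in auto)

text \<open>The differences \<open>a k\<close> of the two logarithmic series all have the same sign,
  so their absolute values sum to |ln t - ln s|. Replacing \<open>p\<close> by \<rho> thus costs at
  most \<epsilon> |ln t - ln s| beyond \<open>K\<close>, and the first \<open>K\<close> terms are
  small when s and t are both close to 0.\<close>

lemma expo_difference:
  assumes s: "0 < s" "s < 1" and t: "0 < t" "t < 1"
    and eps: "\<And>k. K \<le> k \<Longrightarrow> \<bar>p (Suc k) - \<rho>\<bar> \<le> \<epsilon>" "0 \<le> \<epsilon>"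
  shows "\<bar>expo (1 - s) - expo (1 - t) - \<rho> * (ln t - ln s)\<bar>
    \<le> (\<Sum>k<K. \<bar>(1 - s) ^ Suc k - (1 - t) ^ Suc k\<bar>) + \<epsilon> * \<bar>ln t - ln s\<bar>"
proof -
  define a where "a k = (1 - s) ^ Suc k / real (Suc k) - (1 - t) ^ Suc k / real (Suc k)" for k
  have a_sums: "a sums (ln t - ln s)"
    unfolding a_def using sums_diff[OF log_series_sums[of "1 - s"] log_series_sums[of "1 - t"]] s t by simp
  have abs_sums: "(\<lambda>k. \<bar>a k\<bar>) sums \<bar>ln t - ln s\<bar>"
  proof (cases "s \<le> t")
    case True
    then have "0 \<le> a k" for k unfolding a_def using s t
      by (simp add: divide_right_mono power_mono del: power_Suc of_nat_Suc)
    then have "\<bar>a k\<bar> = a k" for k by simp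
    moreover have "\<bar>ln t - ln s\<bar> = ln t - ln s" using True s by simp
    ultimately show ?thesis using a_sums by simp
  next
    case False
    then have "a k \<le> 0" for k unfolding a_def using s t
      by (simp add: divide_right_mono power_mono del: power_Suc of_nat_Suc)
    then have "\<bar>a k\<bar> = - a k" for k by (simp add: abs_of_nonpos)
    moreover have "\<bar>ln t - ln s\<bar> = - (ln t - ln s)" using False t by simp
    ultimately show ?thesis using sums_minus[OF a_sums] by simp
  qed
  have c_sums: "(\<lambda>k. a k * (p (Suc k) - \<rho>)) sums (expo (1 - s) - expo (1 - t) - \<rho> * (ln t - ln s))"
    using sums_diff[OF sums_diff[OF expo_sums[of "1 - s"] expo_sums[of "1 - t"]] sums_mult[OF a_sums, of \<rho>]] s t
    by (simp add: a_def algebra_simps diff_divide_distrib del: power_Suc of_nat_Suc)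
  have head: "(\<lambda>k. if k \<in> {..<K} then \<bar>(1 - s) ^ Suc k - (1 - t) ^ Suc k\<bar> else 0) sums
      (\<Sum>k<K. \<bar>(1 - s) ^ Suc k - (1 - t) ^ Suc k\<bar>)"
    by (rule sums_If_finite_set) simp
  have le: "\<bar>a k * (p (Suc k) - \<rho>)\<bar> \<le> (if k \<in> {..<K} then \<bar>(1 - s) ^ Suc k - (1 - t) ^ Suc k\<bar> else 0) + \<epsilon> * \<bar>a k\<bar>" for k
  proof (cases "k < K")
    case True
    have "\<bar>p (Suc k) - \<rho>\<bar> \<le> 1" using p_bounds[of "Suc k"] rho by auto
    then have "\<bar>a k * (p (Suc k) - \<rho>)\<bar> \<le> \<bar>a k\<bar>" by (simp add: abs_mult mult_left_le)
    also have "\<bar>a k\<bar> = \<bar>(1 - s) ^ Suc k - (1 - t) ^ Suc k\<bar> / real (Suc k)"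
      unfolding a_def by (simp add: diff_divide_distrib[symmetric] abs_divide del: power_Suc of_nat_Suc)
    also have "\<dots> \<le> \<bar>(1 - s) ^ Suc k - (1 - t) ^ Suc k\<bar>"
      by (simp add: divide_le_eq mult_le_cancel_left1 del: power_Suc)
    finally show ?thesis using True eps(2) by (simp add: add_increasing2 del: power_Suc)
  next
    case False
    then show ?thesis using mult_left_mono[OF eps(1)[of k], of "\<bar>a k\<bar>"] by (simp add: abs_mult mult.commute)
  qed
  have rhs: "(\<lambda>k. (if k \<in> {..<K} then \<bar>(1 - s) ^ Suc k - (1 - t) ^ Suc k\<bar> else 0) + \<epsilon> * \<bar>a k\<bar>) sums
     ((\<Sum>k<K. \<bar>(1 - s) ^ Suc k - (1 - t) ^ Suc k\<bar>) + \<epsilon> * \<bar>ln t - ln s\<bar>)"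
    by (rule sums_add[OF head sums_mult[OF abs_sums]])
  have "\<bar>suminf (\<lambda>k. a k * (p (Suc k) - \<rho>))\<bar> \<le>
     suminf (\<lambda>k. (if k \<in> {..<K} then \<bar>(1 - s) ^ Suc k - (1 - t) ^ Suc k\<bar> else 0) + \<epsilon> * \<bar>a k\<bar>)"
    using le norm_suminf_le[OF _ sums_summable[OF rhs], of "\<lambda>k. a k * (p (Suc k) - \<rho>)"] by simp
  then show ?thesis unfolding sums_unique[OF c_sums, symmetric] sums_unique[OF rhs, symmetric] .
qed

text \<open>Regular variation of index \<rho>, in a form that only needs t / s to converge: in
  \<open>U_ff\<close> the argument 1 - exp (- b / r) is merely asymptotic to b / r.\<close>

lemma expo_regular_variation:
  fixes s t :: "'b \<Rightarrow> real"
  assumes s: "(s \<longlongrightarrow> 0) F" "\<forall>\<^sub>F x in F. 0 < s x"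
    and ratio: "((\<lambda>x. t x / s x) \<longlongrightarrow> \<kappa>) F" and k: "0 < \<kappa>"
  shows "((\<lambda>x. exp (expo (1 - s x) - expo (1 - t x))) \<longlongrightarrow> \<kappa> powr \<rho>) F"
proof -
  have t_eq: "\<forall>\<^sub>F x in F. t x = t x / s x * s x" using s(2) by eventually_elim simp
  have "((\<lambda>x. t x / s x * s x) \<longlongrightarrow> \<kappa> * 0) F" by (intro tendsto_mult ratio s)
  then have t: "(t \<longlongrightarrow> 0) F" using tendsto_cong[OF t_eq] by simp
  have ratio_pos: "\<forall>\<^sub>F x in F. 0 < t x / s x" using ratio k by (rule order_tendstoD)
  with s(2) have t_pos: "\<forall>\<^sub>F x in F. 0 < t x" by eventually_elim (simp add: zero_less_divide_iff)
  have lnr: "((\<lambda>x. ln (t x / s x)) \<longlongrightarrow> ln \<kappa>) F" using k by (intro tendsto_ln ratio) simp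
  have "\<forall>\<^sub>F x in F. ln (t x / s x) = ln (t x) - ln (s x)"
    using s(2) t_pos by eventually_elim (simp add: ln_div)
  then have lnd: "((\<lambda>x. ln (t x) - ln (s x)) \<longlongrightarrow> ln \<kappa>) F" by (rule Lim_transform_eventually[OF lnr])
  have "((\<lambda>x. expo (1 - s x) - expo (1 - t x) - \<rho> * (ln (t x) - ln (s x))) \<longlongrightarrow> 0) F"
    unfolding tendsto_iff
  proof (intro allI impI)
    fix e :: real assume e: "0 < e"
    \<comment> \<open>Makes the limit of the error bound at most e / 2; the added 1 covers \<kappa>
      = 1, where the logarithm vanishes.\<close>
    define \<epsilon> where "\<epsilon> = e / (2 * (\<bar>ln \<kappa>\<bar> + 1))"
    have eps: "0 < \<epsilon>" unfolding \<epsilon>_def using e by simp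
    have "\<forall>\<^sub>F k in sequentially. dist (p k) \<rho> < \<epsilon>" using p_lim eps by (simp add: tendsto_iff)
    then obtain K where K0: "\<And>k. K \<le> k \<Longrightarrow> dist (p k) \<rho> < \<epsilon>" by (auto simp: eventually_sequentially)
    then have K: "\<bar>p (Suc k) - \<rho>\<bar> \<le> \<epsilon>" if "K \<le> k" for k
      using less_imp_le[OF K0[of "Suc k"]] that by (simp add: dist_real_def)
    have "((\<lambda>x. (\<Sum>k<K. \<bar>(1 - s x) ^ Suc k - (1 - t x) ^ Suc k\<bar>) + \<epsilon> * \<bar>ln (t x) - ln (s x)\<bar>) \<longlongrightarrow>
        (\<Sum>k<K. \<bar>(1 - 0) ^ Suc k - (1 - 0) ^ Suc k\<bar>) + \<epsilon> * \<bar>ln \<kappa>\<bar>) F"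
      by (intro tendsto_intros s t lnd)
    moreover have "(\<Sum>k<K. \<bar>(1 - 0) ^ Suc k - (1 - 0) ^ Suc k\<bar>) + \<epsilon> * \<bar>ln \<kappa>\<bar> < e"
    proof -
      have "\<epsilon> * \<bar>ln \<kappa>\<bar> \<le> \<epsilon> * (\<bar>ln \<kappa>\<bar> + 1)" using eps by (intro mult_left_mono) auto
      also have "\<dots> = e / 2"
      proof -
        have "e / (2 * w) * w = e / 2" if "0 < w" for w using that by simp
        then show ?thesis unfolding \<epsilon>_def by this (simp add: add_nonneg_pos)
      qed
      finally show ?thesis using e by simp
    qed
    ultimately have "\<forall>\<^sub>F x in F. (\<Sum>k<K. \<bar>(1 - s x) ^ Suc k - (1 - t x) ^ Suc k\<bar>) + \<epsilon> * \<bar>ln (t x) - ln (s x)\<bar> < e"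
      by (rule order_tendstoD)
    moreover have "\<forall>\<^sub>F x in F. s x < 1" "\<forall>\<^sub>F x in F. t x < 1"
      using order_tendstoD(2)[OF s(1), of 1] order_tendstoD(2)[OF t, of 1] by auto
    ultimately show "\<forall>\<^sub>F x in F. dist (expo (1 - s x) - expo (1 - t x) - \<rho> * (ln (t x) - ln (s x))) 0 < e"
      using s(2) t_pos
    proof eventually_elim
      case (elim x)
      then show ?case using expo_difference[of "s x" "t x" K \<epsilon>] K eps by simp
    qed
  qed
  then have "((\<lambda>x. (expo (1 - s x) - expo (1 - t x) - \<rho> * (ln (t x) - ln (s x))) + \<rho> * (ln (t x) - ln (s x))) \<longlongrightarrow> 0 + \<rho> * ln \<kappa>) F"
    by (intro tendsto_intros lnd)
  then have "((\<lambda>x. exp (expo (1 - s x) - expo (1 - t x))) \<longlongrightarrow> exp (\<rho> * ln \<kappa>)) F"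
    by (intro tendsto_exp) simp
  then show ?thesis using k by (simp add: powr_def)
qed

text \<open>\<open>ff\<close> is the function \<open>f\<close> of the statement: the powers of \<open>t\<close> cancel against
  \<open>exp (- \<rho> * (\<Sum>k. y ^ Suc k / Suc k)) = (1 - y) powr \<rho>\<close> at \<open>y = 1 - 1 / t\<close>. The name \<open>f\<close> is
  taken by the law of the first ladder epoch.\<close>
definition ff :: "real \<Rightarrow> real" where "ff t = exp (expo (1 - 1 / t)) / Gamma (\<rho> + 1)"
definition L :: "nat \<Rightarrow> real" where "L n = ln (ln (ff (real n)))"
definition g :: "nat \<Rightarrow> real" where "g n = ff (real n / L n) * L n"

lemma Gamma_pos: "0 < Gamma (\<rho> + 1)" using rho by (intro Gamma_real_pos) simp

lemma ff_pos: "0 < ff t" using Gamma_pos by (simp add: ff_def)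

lemma ff_mono: "1 \<le> s \<Longrightarrow> s \<le> t \<Longrightarrow> ff s \<le> ff t"
  unfolding ff_def using Gamma_pos by (intro divide_right_mono) (auto intro!: expo_mono simp: frac_le)

lemma ff_le: "1 \<le> t \<Longrightarrow> ff t \<le> t / Gamma (\<rho> + 1)"
proof -
  assume t: "1 \<le> t"
  have "expo (1 - 1 / t) \<le> ln t"
    using expo_le_log[of "1 - 1 / t"] t by (simp add: ln_div)
  then have "exp (expo (1 - 1 / t)) \<le> exp (ln t)" by (simp only: exp_le_cancel_iff)
  also have "\<dots> = t" using t by simp
  finally show ?thesis unfolding ff_def using Gamma_pos by (intro divide_right_mono) auto
qed

lemma ff_top: "filterlim ff at_top at_top"
proof -
  have "filterlim (\<lambda>t::real. 1 - 1 / t) (at_left 1) at_top" by real_asymp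
  then have "filterlim (\<lambda>t. exp (expo (1 - 1 / t))) at_top at_top"
    by (intro filterlim_compose[OF exp_at_top] filterlim_compose[OF expo_top])
  then have "filterlim (\<lambda>t. inverse (Gamma (\<rho> + 1)) * exp (expo (1 - 1 / t))) at_top at_top"
    using Gamma_pos by (intro filterlim_tendsto_pos_mult_at_top[OF tendsto_const]) auto
  then show ?thesis by (simp add: ff_def[abs_def] divide_inverse mult.commute)
qed

lemma ff_nat_top: "filterlim (\<lambda>n. ff (real n)) at_top sequentially"
  by (rule filterlim_compose[OF ff_top filterlim_real_sequentially])

lemma L_top: "filterlim L at_top sequentially"
  unfolding L_def[abs_def]
  by (intro filterlim_compose[OF ln_at_top] ff_nat_top)

lemma L_small: "(\<lambda>n. L n / real n) \<longlonglongrightarrow> 0"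
proof (rule tendsto_sandwich[OF _ _ tendsto_const])
  have ev: "\<forall>\<^sub>F n in sequentially. 0 < L n" "\<forall>\<^sub>F n in sequentially. 1 < ff (real n)"
    using L_top ff_nat_top by (auto simp: filterlim_at_top_dense)
  show "\<forall>\<^sub>F n in sequentially. 0 \<le> L n / real n" using ev(1) by eventually_elim simp
  show "\<forall>\<^sub>F n in sequentially. L n / real n \<le> ln (real n / Gamma (\<rho> + 1)) / real n"
    using ev(2) eventually_ge_at_top[of 1]
  proof eventually_elim
    case (elim n)
    have "L n \<le> ln (ff (real n))" unfolding L_def using elim by (intro ln_bound) simp
    also have "\<dots> \<le> ln (real n / Gamma (\<rho> + 1))" using elim ff_le[of "real n"] ff_pos by simp
    finally show ?case by (intro divide_right_mono) auto
  qed
  show "(\<lambda>n. ln (real n / Gamma (\<rho> + 1)) / real n) \<longlonglongrightarrow> 0"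
    using Gamma_pos by real_asymp
qed

lemma n_div_L_top: "filterlim (\<lambda>n. real n / L n) at_top sequentially"
proof -
  have "\<forall>\<^sub>F n in sequentially. 0 < L n / real n"
    using filterlim_at_top_dense[THEN iffD1, OF L_top, rule_format, of 0] eventually_gt_at_top[of 0]
    by eventually_elim simp
  then have "filterlim (\<lambda>n. inverse (L n / real n)) at_top sequentially"
    by (intro filterlim_compose[OF filterlim_inverse_at_top_right] tendsto_imp_filterlim_at_right L_small)
  then show ?thesis by simp
qed

lemma g_top: "filterlim g at_top sequentially"
  unfolding g_def[abs_def]
  by (intro filterlim_at_top_mult_at_top L_top filterlim_compose[OF ff_top n_div_L_top])

text \<open>Crude, but it translates the size of \<open>g n\<close> into the size of
  \<open>ff (real n)\<close>, through which \<open>L n\<close> is defined.\<close>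

lemma g_le: "\<forall>\<^sub>F n in sequentially. 1 \<le> L n \<and> g n \<le> ff (real n) * L n"
proof -
  have "\<forall>\<^sub>F n in sequentially. 1 \<le> L n" "\<forall>\<^sub>F n in sequentially. 1 \<le> real n / L n"
    using L_top n_div_L_top by (auto simp: filterlim_at_top)
  then show ?thesis
  proof eventually_elim
    case (elim n)
    then have "real n / L n \<le> real n" by (simp add: divide_le_eq mult_le_cancel_left1)
    then show ?case unfolding g_def using elim by (intro conjI mult_right_mono ff_mono) auto
  qed
qed

text \<open>One minus the Laplace transform of the first ladder epoch at \<open>b\<close>, hence
  asymptotically its Laplace exponent for small \<open>b\<close>.\<close>

definition U :: "real \<Rightarrow> real" where "U b = 1 - gen (exp (- b))"

lemma U_eq: "0 < b \<Longrightarrow> U b = exp (- expo (exp (- b)))"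
  unfolding U_def by (rule sparre_andersen) simp

lemma U_pos: "0 < b \<Longrightarrow> 0 < U b" by (simp add: U_eq)

text \<open>Up to the factor Gamma (\<rho> + 1), both factors are exponentials of
  \<open>expo\<close> with opposite signs, at distances 1 - exp (- b / r) and 1 / r from 1, whose
  ratio tends to b.\<close>

lemma U_ff:
  assumes r: "filterlim r at_top F" and b: "0 < b"
  shows "((\<lambda>x. U (b / r x) * ff (r x)) \<longlongrightarrow> b powr \<rho> / Gamma (\<rho> + 1)) F"
proof -
  have pos: "\<forall>\<^sub>F x in F. 0 < r x" using r by (simp add: filterlim_at_top_dense)
  have "((\<lambda>t::real. (1 - exp (- (b / t))) / (1 / t)) \<longlongrightarrow> b) at_top" using b by real_asymp
  then have ratio: "((\<lambda>x. (1 - exp (- (b / r x))) / (1 / r x)) \<longlongrightarrow> b) F"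
    by (rule filterlim_compose[OF _ r])
  have "((\<lambda>t::real. 1 / t) \<longlongrightarrow> 0) at_top" by real_asymp
  then have "((\<lambda>x. 1 / r x) \<longlongrightarrow> 0) F" by (rule filterlim_compose[OF _ r])
  from expo_regular_variation[OF this _ ratio b]
  have "((\<lambda>x. exp (expo (1 - 1 / r x) - expo (1 - (1 - exp (- (b / r x)))))) \<longlongrightarrow> b powr \<rho>) F"
    using pos by simp
  then have "((\<lambda>x. exp (expo (1 - 1 / r x) - expo (1 - (1 - exp (- (b / r x))))) / Gamma (\<rho> + 1)) \<longlongrightarrow> b powr \<rho> / Gamma (\<rho> + 1)) F"
    using Gamma_pos by (intro tendsto_divide tendsto_const) auto
  moreover have "\<forall>\<^sub>F x in F. exp (expo (1 - 1 / r x) - expo (1 - (1 - exp (- (b / r x))))) / Gamma (\<rho> + 1) = U (b / r x) * ff (r x)"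
    using pos by eventually_elim (simp add: U_eq b ff_def exp_diff exp_minus field_simps)
  ultimately show ?thesis by (rule Lim_transform_eventually)
qed

lemma U_tendsto_0:
  assumes r: "filterlim r at_top F" and b: "0 < b"
  shows "((\<lambda>x. U (b / r x)) \<longlongrightarrow> 0) F"
proof -
  have "((\<lambda>x. inverse (ff (r x))) \<longlongrightarrow> 0) F"
    by (rule tendsto_inverse_0_at_top) (rule filterlim_compose[OF ff_top r])
  from tendsto_mult[OF U_ff[OF r b] this]
  have "((\<lambda>x. U (b / r x) * ff (r x) * inverse (ff (r x))) \<longlongrightarrow> 0) F" by simp
  moreover have "U z * ff w * inverse (ff w) = U z" for z w using ff_pos[of w] by simp
  ultimately show ?thesis by simp
qed

text \<open>This explains the normalisation: \<open>c * g n\<close> epochs contribute a factor exp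
  (- (c b^\<rho> / Gamma (\<rho> + 1) + o(1)) L n) to the Laplace transform at b L n / n.\<close>

lemma U_g:
  assumes b: "0 < b"
  shows "(\<lambda>n. g n * U (b * L n / real n) / L n) \<longlonglongrightarrow> b powr \<rho> / Gamma (\<rho> + 1)"
proof -
  have "\<forall>\<^sub>F n in sequentially. 0 < L n" using L_top by (simp add: filterlim_at_top_dense)
  then have "\<forall>\<^sub>F n in sequentially. U (b / (real n / L n)) * ff (real n / L n) = g n * U (b * L n / real n) / L n"
    by eventually_elim (simp add: g_def)
  then show ?thesis by (rule Lim_transform_eventually[OF U_ff[OF n_div_L_top b]])
qed

text \<open>The limit of the quotient is 2^\<rho>, which is below 2 because \<rho> < 1. It bounds
  the overshoot of the steps chosen in \<open>AE_records_lower\<close>.\<close>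

lemma ff_doubling: "\<forall>\<^sub>F t in at_top. ff (2 * t) \<le> 2 * ff t"
proof -
  have lim: "((\<lambda>t::real. 1 / (2 * t)) \<longlongrightarrow> 0) at_top" by real_asymp
  have ratio: "((\<lambda>t::real. (1 / t) / (1 / (2 * t))) \<longlongrightarrow> 2) at_top" by real_asymp
  have pos: "\<forall>\<^sub>F t::real in at_top. 0 < 1 / (2 * t)"
    using eventually_gt_at_top[of "0::real"] by eventually_elim simp
  have "((\<lambda>t. exp (expo (1 - 1 / (2 * t)) - expo (1 - 1 / t))) \<longlongrightarrow> 2 powr \<rho>) at_top"
    by (rule expo_regular_variation[OF lim pos ratio]) simp
  moreover have "2 powr \<rho> < (2::real)" using powr_less_mono[of \<rho> 1 2] rho by simp
  ultimately have "\<forall>\<^sub>F t in at_top. exp (expo (1 - 1 / (2 * t)) - expo (1 - 1 / t)) < 2"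
    by (rule order_tendstoD)
  then show ?thesis
    by eventually_elim (use Gamma_pos in \<open>simp add: ff_def exp_diff field_simps\<close>)
qed

end

section \<open>Large deviations of the ladder epochs\<close>

text \<open>The first two right-hand sides equal \<open>\<gamma>\<close> at \<open>\<kappa> = 0\<close> and have positive derivative there.
  For \<open>\<rho> = 0\<close> the parameter \<open>\<sigma>\<close> is negative.\<close>
lemma tilting_parameters:
  fixes \<rho> \<gamma> a :: real
  assumes "0 < a" "\<rho> * \<gamma> < a" "(1 - \<rho>) * \<gamma> < 1" "0 \<le> \<rho> * \<gamma>"
  obtains \<epsilon> \<sigma> \<kappa> where "0 < \<epsilon>" "\<epsilon> < 1" "0 < \<kappa>" "\<kappa> < 1"
    "\<gamma> < \<kappa> * a * (1 - \<epsilon>) + \<gamma> * (1 - \<kappa>) powr \<rho>"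
    "\<gamma> < \<gamma> * (1 + \<kappa>) powr \<rho> - \<kappa> * a * \<sigma>"
    "\<gamma> - a * \<sigma> < 1"
proof -
  \<comment> \<open>The midpoints of the admissible intervals: a (1 - \<epsilon>) lies halfway
    between \<rho> \<gamma> and a, and a \<sigma> halfway between \<gamma> - 1 and \<rho>
    \<gamma>.\<close>
  define \<epsilon> where "\<epsilon> = (1 - \<rho> * \<gamma> / a) / 2"
  define \<sigma> where "\<sigma> = (\<gamma> - 1 + \<rho> * \<gamma>) / (2 * a)"
  have eps: "0 < \<epsilon>" "\<epsilon> < 1" "\<rho> * \<gamma> < a * (1 - \<epsilon>)"
    using assms by (auto simp: \<epsilon>_def field_simps)
  have "a * \<sigma> = (\<gamma> - 1 + \<rho> * \<gamma>) / 2" using assms(1) by (simp add: \<sigma>_def)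
  then have sig: "a * \<sigma> < \<rho> * \<gamma>" "\<gamma> - a * \<sigma> < 1" using assms(3) by (auto simp: algebra_simps)
  have "((\<lambda>k. k * (a * (1 - \<epsilon>)) + \<gamma> * (1 - k) powr \<rho>) has_real_derivative (a * (1 - \<epsilon>) - \<rho> * \<gamma>)) (at 0)"
    by (auto intro!: derivative_eq_intros)
  from DERIV_pos_inc_right[OF this] eps obtain d1 where d1: "0 < d1"
    "\<And>k. 0 < k \<Longrightarrow> k < d1 \<Longrightarrow> \<gamma> < k * (a * (1 - \<epsilon>)) + \<gamma> * (1 - k) powr \<rho>" by auto
  have "((\<lambda>k. \<gamma> * (1 + k) powr \<rho> - k * (a * \<sigma>)) has_real_derivative (\<rho> * \<gamma> - a * \<sigma>)) (at 0)"
    by (auto intro!: derivative_eq_intros)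
  from DERIV_pos_inc_right[OF this] sig obtain d2 where d2: "0 < d2"
    "\<And>k. 0 < k \<Longrightarrow> k < d2 \<Longrightarrow> \<gamma> < \<gamma> * (1 + k) powr \<rho> - k * (a * \<sigma>)" by auto
  define k where "k = min (min d1 d2) 1 / 2"
  have k: "0 < k" "k < d1" "k < d2" "k < 1" using d1(1) d2(1) by (auto simp: k_def)
  show thesis
    using that[of \<epsilon> k \<sigma>] eps sig k d1(2)[of k] d2(2)[of k] by (simp add: mult.assoc)
qed

context regular_walk
begin

lemma exp_power: "exp (- b) ^ k = exp (- b * real k)" for b :: real
  by (metis exp_of_nat_mult mult.commute)

lemma integrable_laplace: "0 < b \<Longrightarrow> integrable W (\<lambda>x. exp (- b * real (ladder_epoch m x)))"
  by (rule W.integrable_const_bound[where B = 1]) auto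

lemma expectation_laplace:
  "0 < b \<Longrightarrow> (\<integral>x. exp (- b * real (ladder_epoch m x)) \<partial>W) = gen (exp (- b)) ^ m"
  using laplace_ladder_epoch[of "exp (- b)" m] by (simp add: exp_power)

lemma sets_ladder_epoch: "{x. real (ladder_epoch m x) \<le> t} \<in> sets W"
  by (intro sets_Collect_W) measurable

lemma chernoff_upper:
  assumes "0 < b"
  shows "W.prob {x. real (ladder_epoch m x) \<le> t} \<le> exp (b * t) * gen (exp (- b)) ^ m"
proof -
  let ?A = "{x. real (ladder_epoch m x) \<le> t}"
  have "W.prob ?A = (\<integral>x. indicator ?A x \<partial>W)" using sets_ladder_epoch by simp
  also have "\<dots> \<le> (\<integral>x. exp (b * t) * exp (- b * real (ladder_epoch m x)) \<partial>W)"
  proof (rule integral_mono)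
    show "integrable W (indicat_real ?A)" using sets_ladder_epoch by (simp add: W.emeasure_eq_measure)
    show "integrable W (\<lambda>x. exp (b * t) * exp (- b * real (ladder_epoch m x)))"
      using integrable_laplace[OF assms] by simp
    show "indicat_real ?A x \<le> exp (b * t) * exp (- b * real (ladder_epoch m x))" for x
      using assms by (auto simp: indicator_def exp_add[symmetric])
  qed
  also have "\<dots> = exp (b * t) * gen (exp (- b)) ^ m" using expectation_laplace[OF assms] by simp
  finally show ?thesis .
qed

text \<open>The expectation of exp (- b T) is split at T = s and T = t. Above t part of the exponent
  is traded for exp (- \<kappa> b t), below s the exponent is increased at the price exp (\<kappa> b
  s), and in between exp (- b T) is at most exp (- b s). The level s may be negative.\<close>

lemma chernoff_lower:
  assumes b: "0 < b" and k: "0 < \<kappa>" "\<kappa> < 1"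
  shows "gen (exp (- b)) ^ m \<le> exp (- b * s) * W.prob {x. real (ladder_epoch m x) \<le> t}
    + exp (- \<kappa> * b * t) * gen (exp (- ((1 - \<kappa>) * b))) ^ m
    + exp (\<kappa> * b * s) * gen (exp (- ((1 + \<kappa>) * b))) ^ m"
proof -
  let ?A = "{x. real (ladder_epoch m x) \<le> t}"
  let ?T = "\<lambda>x. real (ladder_epoch m x)"
  have b': "0 < (1 - \<kappa>) * b" "0 < (1 + \<kappa>) * b" using b k by auto
  have int: "integrable W (indicat_real ?A)" using sets_ladder_epoch by (simp add: W.emeasure_eq_measure)
  have "gen (exp (- b)) ^ m = (\<integral>x. exp (- b * ?T x) \<partial>W)" using expectation_laplace[OF b] by simp
  also have "\<dots> \<le> (\<integral>x. exp (- b * s) * indicat_real ?A x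
     + exp (- \<kappa> * b * t) * exp (- ((1 - \<kappa>) * b) * ?T x)
     + exp (\<kappa> * b * s) * exp (- ((1 + \<kappa>) * b) * ?T x) \<partial>W)"
  proof (rule integral_mono)
    fix x
    let ?u = "?T x"
    have 1: "exp (- b * ?u) \<le> exp (- \<kappa> * b * t) * exp (- ((1 - \<kappa>) * b) * ?u)" if "t \<le> ?u"
      using mult_left_mono[OF that, of "\<kappa> * b"] b k by (simp add: exp_add[symmetric] algebra_simps)
    have 2: "exp (- b * ?u) \<le> exp (\<kappa> * b * s) * exp (- ((1 + \<kappa>) * b) * ?u)" if "?u \<le> s"
      using mult_left_mono[OF that, of "\<kappa> * b"] b k by (simp add: exp_add[symmetric] algebra_simps)
    have 3: "exp (- b * ?u) \<le> exp (- b * s) * indicat_real ?A x" if "s \<le> ?u" "?u \<le> t"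
      using that b by simp
    have nn: "0 \<le> exp (- b * s) * indicat_real ?A x" "0 \<le> exp (- \<kappa> * b * t) * exp (- ((1 - \<kappa>) * b) * ?u)"
      "0 \<le> exp (\<kappa> * b * s) * exp (- ((1 + \<kappa>) * b) * ?u)" by simp_all
    consider "t \<le> ?u" | "?u \<le> s" | "s \<le> ?u" "?u \<le> t" by linarith
    then show "exp (- b * ?u) \<le> exp (- b * s) * indicat_real ?A x
     + exp (- \<kappa> * b * t) * exp (- ((1 - \<kappa>) * b) * ?u) + exp (\<kappa> * b * s) * exp (- ((1 + \<kappa>) * b) * ?u)"
      using 1 2 3 nn by cases linarith+
  qed (intro Bochner_Integration.integrable_add integrable_mult_right int integrable_laplace b b')+
  also have "\<dots> = exp (- b * s) * W.prob ?A
    + exp (- \<kappa> * b * t) * gen (exp (- ((1 - \<kappa>) * b))) ^ m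
    + exp (\<kappa> * b * s) * gen (exp (- ((1 + \<kappa>) * b))) ^ m"
    using int integrable_laplace[OF b'(1), of m] integrable_laplace[OF b'(2), of m]
      expectation_laplace[OF b'(1), of m] expectation_laplace[OF b'(2), of m] sets_ladder_epoch[of m t]
    by simp
  finally show ?thesis .
qed

lemma gen_nonneg: "0 < b \<Longrightarrow> 0 \<le> gen (exp (- b))"
proof -
  assume "0 < b"
  have "0 \<le> (\<integral>x. exp (- b) ^ tau x \<partial>W)" by (rule Bochner_Integration.integral_nonneg) simp
  then show ?thesis using integral_tau[of "exp (- b)"] \<open>0 < b\<close> by simp
qed

lemma gen_power_le: "0 < b \<Longrightarrow> gen (exp (- b)) ^ m \<le> exp (- real m * U b)"
proof -
  assume b: "0 < b"
  have "gen (exp (- b)) \<le> exp (- U b)" using exp_ge_add_one_self[of "- U b"] by (simp add: U_def)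
  then have "gen (exp (- b)) ^ m \<le> exp (- U b) ^ m"
    using gen_nonneg[OF b] by (intro power_mono) auto
  also have "exp (- U b) ^ m = exp (- real m * U b)" by (simp only: exp_power) (simp add: mult.commute)
  finally show ?thesis .
qed

text \<open>Markov's inequality for 1 - exp (- T / t), which is at least 1 - 1 / e >= 1 / 2 when T >
  t; Bernoulli's inequality bounds its expectation by m U (1 / t).\<close>

lemma ladder_epoch_tail:
  assumes "0 < t"
  shows "W.prob {x. t < real (ladder_epoch m x)} \<le> 2 * real m * U (1 / t)"
proof -
  let ?A = "{x. t < real (ladder_epoch m x)}"
  have A: "?A \<in> sets W" by (intro sets_Collect_W) measurable
  have b: "0 < 1 / t" using assms by simp
  have "1 - gen (exp (- (1 / t))) ^ m \<le> real m * U (1 / t)"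
  proof -
    have "gen (exp (- (1 / t))) \<le> 1" using U_pos[OF b] by (simp add: U_def)
    then have "1 + real m * (gen (exp (- (1 / t))) - 1) \<le> (1 + (gen (exp (- (1 / t))) - 1)) ^ m"
      using gen_nonneg[OF b] by (intro Bernoulli_inequality) simp
    then show ?thesis by (simp add: U_def algebra_simps)
  qed
  moreover have "W.prob ?A / 2 \<le> 1 - gen (exp (- (1 / t))) ^ m"
  proof -
    have int: "integrable W (indicat_real ?A)" using A by (simp add: W.emeasure_eq_measure)
    have "W.prob ?A / 2 = (\<integral>x. indicat_real ?A x / 2 \<partial>W)" using A by simp
    also have "\<dots> \<le> (\<integral>x. 1 - exp (- (1 / t) * real (ladder_epoch m x)) \<partial>W)"
    proof (rule integral_mono)
      show "integrable W (\<lambda>x. indicat_real ?A x / 2)" using int by simp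
      show "integrable W (\<lambda>x. 1 - exp (- (1 / t) * real (ladder_epoch m x)))"
        using integrable_laplace[OF b] by simp
      fix x
      show "indicat_real ?A x / 2 \<le> 1 - exp (- (1 / t) * real (ladder_epoch m x))"
      proof (cases "x \<in> ?A")
        case True
        then have "1 \<le> 1 / t * real (ladder_epoch m x)" using assms by (simp add: field_simps)
        then have "exp (- (1 / t) * real (ladder_epoch m x)) \<le> exp (- 1)" by simp
        moreover have "exp (- 1) \<le> (1 / 2 :: real)"
          using exp_ge_add_one_self[of 1] by (simp add: exp_minus field_simps)
        moreover have "indicat_real ?A x = 1" using True by simp
        ultimately show ?thesis by linarith
      qed (use assms in simp)
    qed
    also have "\<dots> = 1 - gen (exp (- (1 / t))) ^ m"
      using integrable_laplace[OF b, of m] expectation_laplace[OF b, of m] W.prob_space by simp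
    finally show ?thesis .
  qed
  ultimately show ?thesis by simp
qed

lemma L_pos: "\<forall>\<^sub>F n in sequentially. 0 < L n"
  using L_top by (simp add: filterlim_at_top_dense)

lemma U_L_tendsto_0:
  assumes "0 < b" shows "(\<lambda>n. U (b * L n / real n)) \<longlonglongrightarrow> 0"
  using U_tendsto_0[OF n_div_L_top assms] by simp

lemma upper_estimate:
  assumes a: "0 < a" and c: "0 < c" and ca: "1 + a < c * a powr \<rho> / Gamma (\<rho> + 1)"
  obtains \<delta> where "0 < \<delta>"
    "\<forall>\<^sub>F n in sequentially. W.prob {x. c * g n < real (records x n)} \<le> exp (- (1 + \<delta>) * L n)"
proof -
  define \<gamma> where "\<gamma> = c * (a powr \<rho> / Gamma (\<rho> + 1))"
  \<comment> \<open>Half of the excess of the Chernoff exponent over 1; the other half absorbs the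
    o(1) terms.\<close>
  define \<delta> where "\<delta> = (\<gamma> - a - 1) / 2"
  have delta: "0 < \<delta>" using ca by (simp add: \<delta>_def \<gamma>_def)
  \<comment> \<open>This vanishing term is the price of rounding \<open>c * g n\<close> down to an
    integer \<open>m\<close>.\<close>
  have "(\<lambda>n. U (a * L n / real n) / L n) \<longlonglongrightarrow> 0"
    by (rule tendsto_divide_0[OF U_L_tendsto_0[OF a] filterlim_at_top_imp_at_infinity[OF L_top]])
  then have "(\<lambda>n. c * (g n * U (a * L n / real n) / L n) - U (a * L n / real n) / L n) \<longlonglongrightarrow> \<gamma> - 0"
    unfolding \<gamma>_def by (intro tendsto_intros U_g a)
  then have "\<forall>\<^sub>F n in sequentially. \<gamma> - \<delta> < c * (g n * U (a * L n / real n) / L n) - U (a * L n / real n) / L n"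
    by (rule order_tendstoD) (use delta in simp)
  moreover have "\<forall>\<^sub>F n in sequentially. 0 < g n" using g_top by (simp add: filterlim_at_top_dense)
  ultimately have "\<forall>\<^sub>F n in sequentially. W.prob {x. c * g n < real (records x n)} \<le> exp (- (1 + \<delta>) * L n)"
    using L_pos eventually_gt_at_top[of 0]
  proof eventually_elim
    case (elim n)
    define b where "b = a * L n / real n"
    define m where "m = nat \<lfloor>c * g n\<rfloor>"
    have b: "0 < b" using a elim by (simp add: b_def)
    have m: "real m \<le> c * g n" "c * g n - 1 \<le> real m"
      using c elim by (auto simp: m_def of_nat_nat)
    have "W.prob {x. c * g n < real (records x n)} \<le> W.prob {x. real (ladder_epoch m x) \<le> real n}"
    proof (rule W.finite_measure_mono_AE[OF _ sets_ladder_epoch])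
      show "AE x in W. x \<in> {x. c * g n < real (records x n)} \<longrightarrow> x \<in> {x. real (ladder_epoch m x) \<le> real n}"
        using AE_ever_passing
      proof eventually_elim
        case (elim x)
        then show ?case using less_records_iff[of x m n] m by auto
      qed
    qed
    also have "\<dots> \<le> exp (b * real n) * gen (exp (- b)) ^ m" by (rule chernoff_upper[OF b])
    also have "\<dots> \<le> exp (b * real n) * exp (- real m * U b)"
      using gen_power_le[OF b] by (intro mult_left_mono) auto
    also have "\<dots> = exp (a * L n - real m * U b)" using elim by (simp add: b_def exp_add[symmetric])
    also have "\<dots> \<le> exp (- (1 + \<delta>) * L n)"
    proof -
      have "(c * g n - 1) * U b \<le> real m * U b" using m U_pos[OF b] by (intro mult_right_mono) auto
      moreover have "(\<gamma> - \<delta>) * L n < (c * (g n * U b / L n) - U b / L n) * L n"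
        using elim by (intro mult_strict_right_mono) (auto simp: b_def)
      moreover have "(c * (g n * U b / L n) - U b / L n) * L n = (c * g n - 1) * U b"
        using elim by (simp add: field_simps)
      moreover have "\<gamma> - \<delta> = a + 1 + \<delta>" by (simp add: \<delta>_def field_simps)
      ultimately show ?thesis by (simp add: algebra_simps)
    qed
    finally show ?case .
  qed
  with delta show thesis by (rule that)
qed

text \<open>The lower estimate also needs the full transform from below, which
  \<open>gen_power_le\<close> cannot give; ln (1 - u) / u tends to -1 and yields the exact
  exponent.\<close>

lemma gen_power_asymp:
  assumes b: "0 < b" and m: "(\<lambda>n. real (m n) / g n) \<longlonglongrightarrow> c"
  shows "(\<lambda>n. real (m n) * ln (gen (exp (- (b * L n / real n)))) / L n) \<longlonglongrightarrow> - (c * (b powr \<rho> / Gamma (\<rho> + 1)))"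
proof -
  let ?U = "\<lambda>n. U (b * L n / real n)"
  have Upos: "\<forall>\<^sub>F n in sequentially. 0 < ?U n"
    using L_pos eventually_gt_at_top[of 0] by eventually_elim (use b in \<open>simp add: U_pos\<close>)
  then have U0: "filterlim ?U (at_right 0) sequentially"
    by (intro tendsto_imp_filterlim_at_right U_L_tendsto_0 b)
  have "((\<lambda>u::real. ln (1 - u) / u) \<longlongrightarrow> -1) (at_right 0)" by real_asymp
  then have "(\<lambda>n. ln (1 - ?U n) / ?U n) \<longlonglongrightarrow> -1" by (rule filterlim_compose[OF _ U0])
  then have "(\<lambda>n. (real (m n) / g n) * (g n * ?U n / L n) * (ln (1 - ?U n) / ?U n)) \<longlonglongrightarrow>
      c * (b powr \<rho> / Gamma (\<rho> + 1)) * -1"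
    by (intro tendsto_mult m U_g b)
  moreover have "\<forall>\<^sub>F n in sequentially. 0 < g n" using g_top by (simp add: filterlim_at_top_dense)
  then have "\<forall>\<^sub>F n in sequentially. (real (m n) / g n) * (g n * ?U n / L n) * (ln (1 - ?U n) / ?U n)
      = real (m n) * ln (gen (exp (- (b * L n / real n)))) / L n"
    using Upos
  proof eventually_elim
    case (elim n)
    have "(m' / g') * (g' * u / l) * (z / u) = m' * z / l" if "0 < g'" "0 < u" for m' g' u l z :: real
      using that by simp
    from this[OF elim] show ?case by (simp add: U_def)
  qed
  ultimately show ?thesis by (auto dest: Lim_transform_eventually)
qed

lemma lower_estimate:
  assumes a: "0 < a" and c: "0 < c" and \<gamma>_def: "\<gamma> = c * (a powr \<rho> / Gamma (\<rho> + 1))"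
    and ca: "\<rho> * \<gamma> < a" "(1 - \<rho>) * \<gamma> < 1" and m: "(\<lambda>n. real (m n) / g n) \<longlonglongrightarrow> c"
  obtains \<epsilon> \<eta> where "0 < \<epsilon>" "\<epsilon> < 1" "0 < \<eta>" "\<eta> < 1"
    "\<forall>\<^sub>F n in sequentially. exp (- (1 - \<eta>) * L n) \<le> W.prob {x. real (ladder_epoch (m n) x) \<le> (1 - \<epsilon>) * real n}"
proof -
  have "0 \<le> \<rho> * \<gamma>" using c rho Gamma_pos by (simp add: \<gamma>_def)
  with a ca obtain \<epsilon> \<sigma> \<kappa> where par: "0 < \<epsilon>" "\<epsilon> < 1" "0 < \<kappa>" "\<kappa> < 1"
    "\<gamma> < \<kappa> * a * (1 - \<epsilon>) + \<gamma> * (1 - \<kappa>) powr \<rho>"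
    "\<gamma> < \<gamma> * (1 + \<kappa>) powr \<rho> - \<kappa> * a * \<sigma>"
    "\<gamma> - a * \<sigma> < 1" by (rule tilting_parameters)
  \<comment> \<open>A common slack for the three strict inequalities. In both outer terms one
    \<open>z\<close> pays for the limits, leaving the exponent \<gamma> + 2 z against \<gamma> + z
    of the full transform; in the third inequality two are spent and one remains as \<eta>.\<close>
  have "\<exists>z. 0 < z \<and> z < 1 \<and> 3 * z \<le> A \<and> 3 * z \<le> B \<and> 3 * z \<le> C" if "0 < A" "0 < B" "0 < C" for A B C :: real
    using that by (intro exI[of _ "min (min A B) (min C 1) / 3"]) auto
  from this[of "\<kappa> * a * (1 - \<epsilon>) + \<gamma> * (1 - \<kappa>) powr \<rho> - \<gamma>"
      "\<gamma> * (1 + \<kappa>) powr \<rho> - \<kappa> * a * \<sigma> - \<gamma>" "1 - (\<gamma> - a * \<sigma>)"] par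
  obtain z where z: "0 < z" "z < 1"
    "\<gamma> + 3 * z \<le> \<kappa> * a * (1 - \<epsilon>) + \<gamma> * (1 - \<kappa>) powr \<rho>"
    "\<gamma> + 3 * z \<le> \<gamma> * (1 + \<kappa>) powr \<rho> - \<kappa> * a * \<sigma>"
    "\<gamma> - a * \<sigma> \<le> 1 - 3 * z"
    by (auto simp: algebra_simps)
  let ?l = "\<lambda>b n. real (m n) * ln (gen (exp (- (b * L n / real n)))) / L n"
  have lim: "?l (k * a) \<longlonglongrightarrow> - (\<gamma> * k powr \<rho>)" if "0 < k" for k
    using gen_power_asymp[OF _ m, of "k * a"] that a by (simp add: \<gamma>_def powr_mult mult_ac)
  have ev: "\<forall>\<^sub>F n in sequentially. - (\<gamma> + z) < ?l a n"
    "\<forall>\<^sub>F n in sequentially. ?l ((1 - \<kappa>) * a) n < - (\<gamma> * (1 - \<kappa>) powr \<rho>) + z"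
    "\<forall>\<^sub>F n in sequentially. ?l ((1 + \<kappa>) * a) n < - (\<gamma> * (1 + \<kappa>) powr \<rho>) + z"
    using order_tendstoD(1)[OF lim[of 1], of "- (\<gamma> + z)"] order_tendstoD(2)[OF lim[of "1 - \<kappa>"]]
      order_tendstoD(2)[OF lim[of "1 + \<kappa>"]] z par by auto
  \<comment> \<open>Keeps \<open>gen\<close> positive at these arguments, so that its powers are
    exponentials of \<open>?l\<close>.\<close>
  have U1: "\<forall>\<^sub>F n in sequentially. U (k * a * L n / real n) < 1" if "0 < k" for k
    using U_L_tendsto_0[of "k * a"] by (rule order_tendstoD) (use that a in auto)
  have U1s: "\<forall>\<^sub>F n in sequentially. U (a * L n / real n) < 1"
    "\<forall>\<^sub>F n in sequentially. U ((1 - \<kappa>) * a * L n / real n) < 1"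
    "\<forall>\<^sub>F n in sequentially. U ((1 + \<kappa>) * a * L n / real n) < 1"
    using U1[of 1] U1[of "1 - \<kappa>"] U1[of "1 + \<kappa>"] par by simp_all
  \<comment> \<open>Then exp (z * L n) is at least 3: after subtracting the two outer terms, one
    copy of their common bound is left for the middle range.\<close>
  have Lz: "\<forall>\<^sub>F n in sequentially. ln 3 / z < L n" using L_top by (simp add: filterlim_at_top_dense)
  have "\<forall>\<^sub>F n in sequentially. exp (- (1 - z) * L n) \<le> W.prob {x. real (ladder_epoch (m n) x) \<le> (1 - \<epsilon>) * real n}"
    using ev L_pos eventually_gt_at_top[of 0] Lz U1s
  proof eventually_elim
    case (elim n)
    let ?P = "W.prob {x. real (ladder_epoch (m n) x) \<le> (1 - \<epsilon>) * real n}"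
    define G where "G b = gen (exp (- (b * L n / real n))) ^ m n" for b
    have G: "G b = exp (L n * ?l b n)" if "U (b * L n / real n) < 1" for b
    proof -
      have "0 < gen (exp (- (b * L n / real n)))" using that by (simp add: U_def)
      then show ?thesis using elim by (simp add: G_def exp_of_nat_mult)
    qed
    have "0 < a * L n / real n" using elim a by simp
    from chernoff_lower[OF this par(3,4), where m = "m n" and s = "\<sigma> * real n" and t = "(1 - \<epsilon>) * real n"]
    have "G a \<le> exp (- (a * \<sigma>) * L n) * ?P + exp (- (\<kappa> * a * (1 - \<epsilon>)) * L n) * G ((1 - \<kappa>) * a)
        + exp (\<kappa> * a * \<sigma> * L n) * G ((1 + \<kappa>) * a)"
      using elim by (simp add: G_def mult_ac)
    also have "exp (- (\<kappa> * a * (1 - \<epsilon>)) * L n) * G ((1 - \<kappa>) * a) \<le> exp (- (\<gamma> + 2 * z) * L n)"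
    proof -
      have "- (\<kappa> * a * (1 - \<epsilon>)) + ?l ((1 - \<kappa>) * a) n \<le> - (\<gamma> + 2 * z)" using elim z by linarith
      from mult_right_mono[OF this, of "L n"] elim show ?thesis
        by (subst G) (auto simp: exp_add[symmetric] algebra_simps)
    qed
    also have "exp (\<kappa> * a * \<sigma> * L n) * G ((1 + \<kappa>) * a) \<le> exp (- (\<gamma> + 2 * z) * L n)"
    proof -
      have "\<kappa> * a * \<sigma> + ?l ((1 + \<kappa>) * a) n \<le> - (\<gamma> + 2 * z)" using elim z by linarith
      from mult_right_mono[OF this, of "L n"] elim show ?thesis
        by (subst G) (auto simp: exp_add[symmetric] algebra_simps)
    qed
    finally have 1: "G a \<le> exp (- (a * \<sigma>) * L n) * ?P + 2 * exp (- (\<gamma> + 2 * z) * L n)" by simp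
    have 2: "exp (- (\<gamma> + z) * L n) \<le> G a"
      using mult_right_mono[OF less_imp_le[OF elim(1)], of "L n"] elim by (subst G) (auto simp: mult.commute)
    have 3: "3 * exp (- (\<gamma> + 2 * z) * L n) \<le> exp (- (\<gamma> + z) * L n)"
    proof -
      have "ln 3 \<le> z * L n" using elim z by (simp add: divide_less_eq mult.commute)
      then have "exp (ln 3) \<le> exp (z * L n)" by (simp only: exp_le_cancel_iff)
      then have "3 \<le> exp (z * L n)" by simp
      then have "3 * exp (- (\<gamma> + 2 * z) * L n) \<le> exp (z * L n) * exp (- (\<gamma> + 2 * z) * L n)"
        by (intro mult_right_mono) auto
      then show ?thesis by (simp add: exp_add[symmetric] algebra_simps)
    qed
    have "exp (- (\<gamma> + 2 * z) * L n) \<le> exp (- (a * \<sigma>) * L n) * ?P" using 1 2 3 by linarith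
    from mult_left_mono[OF this, of "exp (a * \<sigma> * L n)"]
    have "exp (a * \<sigma> * L n) * exp (- (\<gamma> + 2 * z) * L n) \<le> ?P"
      unfolding mult.assoc[symmetric] exp_add[symmetric] by simp
    moreover have "exp (a * \<sigma> * L n) * exp (- (\<gamma> + 2 * z) * L n) = exp (- (\<gamma> - a * \<sigma> + 2 * z) * L n)"
      unfolding exp_add[symmetric] by (simp add: algebra_simps)
    moreover have "exp (- (1 - z) * L n) \<le> exp (- (\<gamma> - a * \<sigma> + 2 * z) * L n)"
      using mult_right_mono[of "- (1 - z)" "- (\<gamma> - a * \<sigma> + 2 * z)" "L n"] z elim by simp
    ultimately show ?case by linarith
  qed
  with par z show thesis by (intro that) auto
qed

end

section \<open>The law of the iterated logarithm\<close>

lemma records_mono: "m \<le> n \<Longrightarrow> records x m \<le> records x n"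
  unfolding records_def by (intro card_mono) auto

lemma ln_fact_le: "ln (fact k :: real) \<le> real k * ln (real k)"
proof (cases "k = 0")
  case False
  have "ln (fact k :: real) \<le> ln (real k ^ k)"
    using fact_le_power[of k, where 'a = real] False by simp
  then show ?thesis using False by (simp add: ln_realpow)
qed simp

context regular_walk
begin

text \<open>Only one step per geometric range of the normalisation \<open>g\<close> needs to be controlled, namely the
  last one; this avoids any monotonicity of \<open>g\<close>.\<close>
theorem AE_records_upper:
  assumes a: "0 < a" and c: "0 < c" and ca: "1 + a < c * a powr \<rho> / Gamma (\<rho> + 1)" and r: "1 < r"
  shows "AE x in W. \<forall>\<^sub>F n in sequentially. real (records x n) \<le> c * r * g n"
proof -
  obtain \<delta> where delta: "0 < \<delta>" and ev:
    "\<forall>\<^sub>F n in sequentially. W.prob {x. c * g n < real (records x n)} \<le> exp (- (1 + \<delta>) * L n)"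
    by (rule upper_estimate[OF a c ca])
  have lnff: "\<forall>\<^sub>F n in sequentially. 1 < ln (ff (real n))"
    using filterlim_compose[OF ln_at_top ff_nat_top] by (simp add: filterlim_at_top_dense)
  have "\<forall>\<^sub>F n in sequentially. W.prob {x. c * g n < real (records x n)} \<le> exp (- (1 + \<delta>) * L n)
      \<and> 1 < ln (ff (real n)) \<and> g n \<le> ff (real n) ^ 2"
    using ev lnff g_le
  proof eventually_elim
    case (elim n)
    have "L n \<le> ln (ff (real n))" unfolding L_def using elim by (intro ln_bound) simp
    also have "\<dots> \<le> ff (real n)" using ff_pos by (intro ln_bound)
    finally have "ff (real n) * L n \<le> ff (real n) ^ 2"
      using ff_pos[of "real n"] by (simp add: power2_eq_square)
    then show ?case using elim by auto
  qed
  then obtain n1 where n1: "\<And>n. n1 \<le> n \<Longrightarrow> W.prob {x. c * g n < real (records x n)} \<le> exp (- (1 + \<delta>) * L n)"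
    "\<And>n. n1 \<le> n \<Longrightarrow> 1 < ln (ff (real n))" "\<And>n. n1 \<le> n \<Longrightarrow> g n \<le> ff (real n) ^ 2"
    by (auto simp: eventually_sequentially)
  define N where "N k = {n. n1 \<le> n \<and> r ^ k \<le> g n \<and> g n < r ^ Suc k}" for k
  have fin: "finite (N k)" for k
  proof -
    have "\<forall>\<^sub>F n in sequentially. r ^ Suc k \<le> g n" using g_top by (simp add: filterlim_at_top)
    then obtain n2 where "\<And>n. n2 \<le> n \<Longrightarrow> r ^ Suc k \<le> g n" by (auto simp: eventually_sequentially)
    then have "N k \<subseteq> {..<n2}" unfolding N_def by (auto simp: not_le[symmetric] simp del: power_Suc)
    then show ?thesis by (rule finite_subset) simp
  qed
  define B where "B k = {x. N k \<noteq> {} \<and> c * g (Max (N k)) < real (records x (Max (N k)))}" for k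
  have B_sets: "B k \<in> sets W" for k unfolding B_def by (intro sets_Collect_W) measurable
  \<comment> \<open>On \<open>N k\<close> the bound g <= ff^2 gives ln (ff n) >= k ln r / 2, and exp
    (- (1 + \<delta>) L n) is the power - (1 + \<delta>) of ln (ff n), hence summable in k.\<close>
  have B_le: "W.prob (B k) \<le> (ln r / 2) powr (- (1 + \<delta>)) * real k powr (- (1 + \<delta>))" if k: "1 \<le> k" for k
  proof (cases "N k = {}")
    case False
    let ?n = "Max (N k)"
    have "?n \<in> N k" using fin False by (rule Max_in)
    then have n: "n1 \<le> ?n" "r ^ k \<le> g ?n" by (auto simp: N_def)
    have "r ^ k \<le> ff (real ?n) ^ 2" using n n1(3) by force
    then have "ln (r ^ k) \<le> ln (ff (real ?n) ^ 2)" using r ff_pos[of "real ?n"] by simp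
    then have le: "real k * (ln r / 2) \<le> ln (ff (real ?n))"
      using r ff_pos[of "real ?n"] by (simp add: ln_realpow)
    have "W.prob (B k) \<le> exp (- (1 + \<delta>) * L ?n)" using n1(1)[OF n(1)] False by (simp add: B_def)
    also have "\<dots> = ln (ff (real ?n)) powr (- (1 + \<delta>))"
      using n1(2)[OF n(1)] by (simp add: L_def powr_def)
    also have "\<dots> \<le> (real k * (ln r / 2)) powr (- (1 + \<delta>))"
      using le k r delta by (intro powr_mono2') auto
    also have "\<dots> = (ln r / 2) powr (- (1 + \<delta>)) * real k powr (- (1 + \<delta>))"
      using r by (subst powr_mult) auto
    finally show ?thesis .
  qed (simp add: B_def)
  have "summable (\<lambda>k. W.prob (B k))"
  proof (rule summable_comparison_test')
    show "summable (\<lambda>k. (ln r / 2) powr (- (1 + \<delta>)) * real k powr (- (1 + \<delta>)))"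
      using delta by (intro summable_mult) (simp add: summable_real_powr_iff)
  qed (use B_le in simp)
  then have "AE x in W. \<forall>\<^sub>F k in sequentially. x \<in> space W - B k"
    by (intro borel_cantelli_AE1 B_sets) (simp_all add: W.emeasure_eq_measure)
  then show ?thesis
  proof eventually_elim
    case (elim x)
    then obtain K where K: "\<And>k. K \<le> k \<Longrightarrow> x \<notin> B k" by (auto simp: eventually_sequentially)
    have "\<forall>\<^sub>F n in sequentially. r ^ K \<le> g n" using g_top by (simp add: filterlim_at_top)
    then show ?case using eventually_ge_at_top[of n1]
    proof eventually_elim
      case (elim n)
      have g1: "1 \<le> g n" using elim(1) one_le_power[of r K] r by linarith
      define k where "k = nat \<lfloor>log r (g n)\<rfloor>"
      have lg: "0 \<le> log r (g n)" using g1 r by simp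
      have "r powr real k \<le> g n" using lg g1 r by (subst powr_le_iff) (auto simp: k_def)
      then have k1: "r ^ k \<le> g n" using r by (simp add: powr_realpow)
      have "g n < r powr real (Suc k)" using lg g1 r
        by (subst less_powr_iff) (auto simp: k_def, linarith)
      then have k2: "g n < r ^ Suc k" using r by (simp add: powr_realpow del: power_Suc of_nat_Suc)
      have "r ^ K < r ^ Suc k" using elim(1) k2 by linarith
      then have Kk: "K \<le> k" using r by (simp add: power_strict_increasing_iff del: power_Suc)
      have nN: "n \<in> N k" using elim k1 k2 by (simp add: N_def)
      then have mx: "n \<le> Max (N k)" "Max (N k) \<in> N k" using fin by (auto intro: Max_in)
      have "real (records x n) \<le> real (records x (Max (N k)))" using mx by (simp add: records_mono)
      also have "\<dots> \<le> c * g (Max (N k))" using K[OF Kk] nN by (auto simp: B_def)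
      also have "\<dots> \<le> c * r ^ Suc k" using mx(2) c by (simp add: N_def)
      also have "\<dots> \<le> c * r * g n" using k1 c r by simp
      finally show ?case .
    qed
  qed
qed

text \<open>The steps \<open>N k\<close> are chosen with \<open>ff (N k)\<close> close to \<open>(k!)\<^sup>4\<close>: fast enough for the sum of the
  earlier blocks to be negligible, slow enough for the block probabilities, which are at least
  \<open>ln (ff (N k)) powr - (1 - \<eta>)\<close>, to have a divergent sum.\<close>
theorem AE_records_lower:
  assumes a: "0 < a" and c: "0 < c" and \<gamma>_def: "\<gamma> = c * (a powr \<rho> / Gamma (\<rho> + 1))"
    and ca: "\<rho> * \<gamma> < a" "(1 - \<rho>) * \<gamma> < 1"
  shows "AE x in W. \<exists>\<^sub>F n in sequentially. c * g n \<le> real (records x n)"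
proof -
  define mm where "mm n = nat \<lceil>c * g n\<rceil>" for n
  have mm: "c * g n \<le> real (mm n)" for n unfolding mm_def by linarith
  have g_pos: "\<forall>\<^sub>F n in sequentially. 0 < g n" using g_top by (simp add: filterlim_at_top_dense)
  have mm_le: "\<forall>\<^sub>F n in sequentially. real (mm n) \<le> c * g n + 1"
    using g_pos by eventually_elim (use c in \<open>simp add: mm_def of_nat_nat\<close>)
  have "(\<lambda>n. real (mm n) / g n) \<longlonglongrightarrow> c"
  proof (rule tendsto_sandwich[OF _ _ tendsto_const])
    show "\<forall>\<^sub>F n in sequentially. c \<le> real (mm n) / g n"
      using g_pos by eventually_elim (use mm in \<open>simp add: le_divide_eq\<close>)
    show "\<forall>\<^sub>F n in sequentially. real (mm n) / g n \<le> c + inverse (g n)"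
      using g_pos mm_le by eventually_elim (simp add: divide_le_eq distrib_right)
    have "(\<lambda>n. inverse (g n)) \<longlonglongrightarrow> 0" by (rule tendsto_inverse_0_at_top[OF g_top])
    from tendsto_add[OF tendsto_const this] show "(\<lambda>n. c + inverse (g n)) \<longlonglongrightarrow> c" by simp
  qed
  from lower_estimate[OF a c \<gamma>_def ca this] obtain \<epsilon> \<eta> where par: "0 < \<epsilon>" "\<epsilon> < 1" "0 < \<eta>" "\<eta> < 1"
    and low: "\<forall>\<^sub>F n in sequentially. exp (- (1 - \<eta>) * L n) \<le> W.prob {x. real (ladder_epoch (mm n) x) \<le> (1 - \<epsilon>) * real n}"
    by blast
  define v :: "nat \<Rightarrow> real" where "v k = fact k ^ 4" for k
  have v_ge: "1 \<le> v k" for k unfolding v_def by (simp add: fact_ge_1)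
  have v_Suc: "v (Suc k) = real (Suc k) ^ 4 * v k" for k by (simp add: v_def power_mult_distrib)
  have v_mono: "j \<le> k \<Longrightarrow> v j \<le> v k" for j k unfolding v_def by (intro power_mono fact_mono) auto
  have v_top: "filterlim v at_top sequentially"
  proof (rule filterlim_at_top_mono[OF filterlim_real_sequentially always_eventually], rule allI)
    fix k
    have "real k \<le> fact k" using fact_ge_self[of k] by (metis of_nat_fact of_nat_le_iff)
    also have "\<dots> \<le> v k" unfolding v_def using fact_ge_1[of k] by (intro self_le_power) auto
    finally show "real k \<le> v k" .
  qed
  have ln_v: "ln (2 * v k) \<le> ln 2 + 4 * (real k * ln (real k))" for k
    using ln_fact_le[of k] by (simp add: v_def ln_mult ln_realpow)

  define N where "N k = (LEAST n. v k \<le> ff (real n))" for k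
  have N: "v k \<le> ff (real (N k))" for k
  proof -
    have "\<forall>\<^sub>F n in sequentially. v k \<le> ff (real n)" using ff_nat_top by (simp add: filterlim_at_top)
    then have "\<exists>n. v k \<le> ff (real n)" by (auto simp: eventually_sequentially)
    then show ?thesis unfolding N_def by (rule LeastI_ex)
  qed
  have N_top: "filterlim N at_top sequentially"
    unfolding filterlim_at_top
  proof
    fix Z
    have "\<forall>\<^sub>F k in sequentially. Max ((\<lambda>n. ff (real n)) ` {..Z}) < v k"
      using v_top unfolding filterlim_at_top_dense by (rule spec)
    then show "\<forall>\<^sub>F k in sequentially. Z \<le> N k"
    proof eventually_elim
      case (elim k)
      show ?case
      proof (rule ccontr)
        assume "\<not> Z \<le> N k"
        then have "ff (real (N k)) \<le> Max ((\<lambda>n. ff (real n)) ` {..Z})" by (intro Max_ge) auto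
        then show False using elim N[of k] by simp
      qed
    qed
  qed
  have realN_top: "filterlim (\<lambda>k. real (N k)) at_top sequentially"
    by (rule filterlim_compose[OF filterlim_real_sequentially N_top])
  \<comment> \<open>Minimality of \<open>N k\<close> bounds \<open>ff\<close> one step earlier by
    \<open>v k\<close>, and doubling the argument covers the missing step.\<close>
  have ffN: "\<forall>\<^sub>F k in sequentially. ff (real (N k)) \<le> 2 * v k"
  proof -
    obtain t0 where t0: "\<And>t. t0 \<le> t \<Longrightarrow> ff (2 * t) \<le> 2 * ff t"
      using ff_doubling by (auto simp: eventually_at_top_linorder)
    have "\<forall>\<^sub>F k in sequentially. max 2 (t0 + 1) \<le> real (N k)"
      using realN_top unfolding filterlim_at_top by (rule spec)
    then show ?thesis
    proof eventually_elim
      case (elim k)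
      have eq: "real (N k - 1) = real (N k) - 1" using elim by (subst of_nat_diff) auto
      have "ff (real (N k)) \<le> ff (2 * real (N k - 1))" unfolding eq using elim by (intro ff_mono) auto
      also have "\<dots> \<le> 2 * ff (real (N k - 1))" using elim by (intro t0) (simp add: eq)
      also have "ff (real (N k - 1)) \<le> v k"
        using not_less_Least[of "N k - 1" "\<lambda>n. v k \<le> ff (real n)"] elim by (fold N_def) auto
      finally show ?case by simp
    qed
  qed
  have lnffN: "\<forall>\<^sub>F k in sequentially. 1 < ln (ff (real (N k))) \<and> ln (ff (real (N k))) \<le> ln 2 + 4 * (real k * ln (real k))"
  proof -
    have "\<forall>\<^sub>F k in sequentially. 1 < ln (ff (real (N k)))"
      using filterlim_compose[OF ln_at_top filterlim_compose[OF ff_top realN_top]] by (simp add: filterlim_at_top_dense)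
    then show ?thesis using ffN
    proof eventually_elim
      case (elim k)
      have "ln (ff (real (N k))) \<le> ln (2 * v k)" using elim ff_pos[of "real (N k)"] v_ge[of k] by simp
      then show ?case using elim ln_v[of k] by simp
    qed
  qed

  define m where "m k = mm (N k)" for k
  define M where "M k = (\<Sum>j<k. m j)" for k
  have "\<forall>\<^sub>F k in sequentially. real (m k) \<le> (2 * c + 1) * (real (Suc k) * v k)"
  proof -
    have ev1: "\<forall>\<^sub>F k::nat in sequentially. ln (ln 2 + 4 * (real k * ln (real k))) \<le> real k" by real_asymp
    have ev2: "\<forall>\<^sub>F k in sequentially. 1 \<le> L (N k) \<and> g (N k) \<le> ff (real (N k)) * L (N k)"
      using N_top g_le by (rule eventually_compose_filterlim[rotated])
    have ev3: "\<forall>\<^sub>F k in sequentially. real (m k) \<le> c * g (N k) + 1"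
      unfolding m_def using N_top mm_le by (rule eventually_compose_filterlim[rotated])
    show ?thesis using ev1 ev2 ev3 lnffN ffN
    proof eventually_elim
      case (elim k)
      have "L (N k) \<le> ln (ln 2 + 4 * (real k * ln (real k)))" unfolding L_def using elim by (subst ln_le_cancel_iff) auto
      with elim have "L (N k) \<le> real (Suc k)" by simp
      then have "ff (real (N k)) * L (N k) \<le> 2 * v k * real (Suc k)"
        using elim ff_pos[of "real (N k)"] v_ge[of k] by (intro mult_mono) auto
      then have "c * g (N k) \<le> c * (2 * v k * real (Suc k))" using elim c by (intro mult_left_mono) auto
      moreover have "1 \<le> real (Suc k) * v k" using v_ge[of k] mult_mono[of 1 "real (Suc k)" 1 "v k"] by simp
      ultimately show ?case using elim by (simp add: algebra_simps)
    qed
  qed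
  then obtain k0 where k0: "\<And>k. k0 \<le> k \<Longrightarrow> real (m k) \<le> (2 * c + 1) * (real (Suc k) * v k)"
    by (auto simp: eventually_sequentially)
  \<comment> \<open>The finite sum covers the indices below \<open>k0\<close>, where the eventual
    bound says nothing.\<close>
  define C where "C = 2 * c + 1 + (\<Sum>j<k0. real (m j))"
  have C0: "0 \<le> C" using c by (simp add: C_def sum_nonneg)
  have m_le: "real (m k) \<le> C * (real (Suc k) * v k)" for k
  proof -
    have w: "1 \<le> real (Suc k) * v k" using v_ge[of k] mult_mono[of 1 "real (Suc k)" 1 "v k"] by simp
    show ?thesis
    proof (cases "k0 \<le> k")
      case True
      have "(2 * c + 1) * (real (Suc k) * v k) \<le> C * (real (Suc k) * v k)"
        using w by (intro mult_right_mono) (auto simp: C_def sum_nonneg)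
      with k0[OF True] show ?thesis by linarith
    next
      case False
      then have "real (m k) \<le> (\<Sum>j<k0. real (m j))" by (intro member_le_sum) auto
      also have "\<dots> \<le> C * 1" using c by (simp add: C_def)
      also have "\<dots> \<le> C * (real (Suc k) * v k)" using w C0 by (intro mult_left_mono) auto
      finally show ?thesis .
    qed
  qed
  have M_le: "real (M (Suc k)) \<le> C * real (Suc k) ^ 2 * v k" for k
  proof -
    have "real (M (Suc k)) = (\<Sum>j<Suc k. real (m j))" by (simp add: M_def)
    also have "\<dots> \<le> real (card {..<Suc k}) * (C * (real (Suc k) * v k))"
    proof (rule sum_bounded_above)
      fix j assume "j \<in> {..<Suc k}"
      then have "C * (real (Suc j) * v j) \<le> C * (real (Suc k) * v k)"
        using C0 v_mono[of j k] v_ge[of j] by (intro mult_left_mono mult_mono) auto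
      with m_le[of j] show "real (m j) \<le> C * (real (Suc k) * v k)" by linarith
    qed
    finally show ?thesis by (simp add: power2_eq_square mult_ac)
  qed

  \<comment> \<open>The failure probability at k + 1 is of order M (k+1) / ff (N (k+1)), hence at
    most of order (k+1)^2 v k / ((k+1)^4 v k). The fourth power of the factorial makes this
    summable.\<close>
  have early: "AE x in W. \<forall>\<^sub>F k in sequentially. real (ladder_epoch (M k) x) \<le> \<epsilon> * real (N k)"
  proof -
    define A where "A k = {x. \<epsilon> * real (N (Suc k)) < real (ladder_epoch (M (Suc k)) x)}" for k
    have A: "A k \<in> sets W" for k unfolding A_def by (intro sets_Collect_W) measurable
    define D where "D = (1 / \<epsilon>) powr \<rho> / Gamma (\<rho> + 1) + 1"
    have "\<forall>\<^sub>F k in sequentially. U ((1 / \<epsilon>) / real (N k)) * ff (real (N k)) < D"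
      using U_ff[OF realN_top, of "1 / \<epsilon>"] par by (intro order_tendstoD(2)[where y = "(1 / \<epsilon>) powr \<rho> / Gamma (\<rho> + 1)"]) (auto simp: D_def)
    moreover have "\<forall>\<^sub>F k in sequentially. 0 < real (N k)"
      using realN_top unfolding filterlim_at_top_dense by (rule spec)
    ultimately have "\<forall>\<^sub>F k in sequentially. 0 < real (N k) \<and> U ((1 / \<epsilon>) / real (N k)) * ff (real (N k)) < D"
      by eventually_elim simp
    then obtain k1 where k1: "\<And>k. k1 \<le> k \<Longrightarrow> 0 < real (N k) \<and> U ((1 / \<epsilon>) / real (N k)) * ff (real (N k)) < D"
      by (auto simp: eventually_sequentially)
    have A_le: "W.prob (A k) \<le> 2 * C * D * inverse (real (Suc k) ^ 2)" if k: "k1 \<le> k" for k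
    proof -
      let ?n = "real (N (Suc k))"
      have n: "0 < ?n" "U ((1 / \<epsilon>) / ?n) * ff ?n < D" using k1[of "Suc k"] k by auto
      have Up: "0 < U ((1 / \<epsilon>) / ?n)" using n par by (intro U_pos) simp
      have "W.prob (A k) \<le> 2 * real (M (Suc k)) * U (1 / (\<epsilon> * ?n))"
        unfolding A_def using n par by (intro ladder_epoch_tail) simp
      also have "\<dots> = 2 * real (M (Suc k)) * U ((1 / \<epsilon>) / ?n)" by simp
      also have "\<dots> \<le> 2 * (C * real (Suc k) ^ 2 * v k) * (D / v (Suc k))"
      proof (intro mult_mono)
        have "U ((1 / \<epsilon>) / ?n) * v (Suc k) \<le> U ((1 / \<epsilon>) / ?n) * ff ?n"
          using N Up by (intro mult_left_mono) auto
        then show "U ((1 / \<epsilon>) / ?n) \<le> D / v (Suc k)"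
          using n v_ge[of "Suc k"] by (simp add: le_divide_eq)
      qed (use M_le[of k] C0 v_ge[of k] Up in \<open>auto intro: order_trans simp del: power_Suc of_nat_Suc\<close>)
      also have "\<dots> = 2 * C * D * inverse (real (Suc k) ^ 2)"
      proof -
        have "2 * (C * s ^ 2 * w) * (D / (s ^ 4 * w)) = 2 * C * D * inverse (s ^ 2)" if "0 < s" "0 < w" for s w :: real
          using that by (simp add: field_simps eval_nat_numeral)
        from this[of "real (Suc k)" "v k"] show ?thesis unfolding v_Suc using v_ge[of k] by simp
      qed
      finally show ?thesis .
    qed
    have "summable (\<lambda>k. W.prob (A k))"
    proof (rule summable_comparison_test')
      have "summable (\<lambda>k. inverse (real (Suc k) ^ 2))"
        using inverse_power_summable[of 2, where 'a = real] by (subst summable_Suc_iff) simp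
      then show "summable (\<lambda>k. 2 * C * D * inverse (real (Suc k) ^ 2))" by (rule summable_mult)
    qed (use A_le in simp)
    then have "AE x in W. \<forall>\<^sub>F k in sequentially. x \<in> space W - A k"
      by (intro borel_cantelli_AE1 A) (simp_all add: W.emeasure_eq_measure)
    then show ?thesis
    proof eventually_elim
      case (elim x)
      then have "\<forall>\<^sub>F k in sequentially. real (ladder_epoch (M (Suc k)) x) \<le> \<epsilon> * real (N (Suc k))"
        by eventually_elim (simp add: A_def not_less)
      then show ?case by (subst (asm) eventually_sequentially_Suc)
    qed
  qed

  define q where "q k = W.prob {x. real (ladder_epoch (m k) x) \<le> (1 - \<epsilon>) * real (N k)}" for k
  have q_ge: "\<forall>\<^sub>F k in sequentially. inverse (real k) \<le> q k"
  proof -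
    have ev1: "\<forall>\<^sub>F k in sequentially. exp (- (1 - \<eta>) * L (N k)) \<le> q k"
      unfolding q_def m_def using N_top low by (rule eventually_compose_filterlim[rotated])
    \<comment> \<open>The gap \<eta> absorbs the factor ln k that comes from the logarithm of the
      factorial.\<close>
    have ev2: "\<forall>\<^sub>F k::nat in sequentially. (ln 2 + 4 * (real k * ln (real k))) powr (1 - \<eta>) \<le> real k"
      using par by real_asymp
    show ?thesis using ev1 ev2 lnffN eventually_gt_at_top[of 0]
    proof eventually_elim
      case (elim k)
      let ?l = "ln (ff (real (N k)))"
      have "?l powr (1 - \<eta>) \<le> (ln 2 + 4 * (real k * ln (real k))) powr (1 - \<eta>)"
        using elim par by (intro powr_mono2) auto
      with elim have "?l powr (1 - \<eta>) \<le> real k" by linarith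
      then have "inverse (real k) \<le> inverse (?l powr (1 - \<eta>))" using elim by (intro le_imp_inverse_le) auto
      also have "\<dots> = exp (- (1 - \<eta>) * L (N k))"
        using elim by (simp add: L_def powr_def exp_minus[symmetric] left_diff_distrib)
      finally show ?case using elim by linarith
    qed
  qed
  have q01: "0 \<le> q k" "q k \<le> 1" for k by (simp_all add: q_def)
  have q_div: "filterlim (\<lambda>n. \<Sum>k\<in>{K..<n}. q k) at_top sequentially" for K
  proof -
    have "\<not> summable q"
    proof
      assume "summable q"
      then have "summable (\<lambda>k. inverse (real k))"
        by (rule summable_comparison_test_ev[rotated]) (use q_ge in \<open>auto elim: eventually_mono\<close>)
      then show False using not_summable_harmonic[where 'a = real] by simp
    qed
    then have "\<not> summable (\<lambda>k. q (k + K))" by (simp add: summable_iff_shift)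
    then have "filterlim (\<lambda>n. \<Sum>k<n. q (k + K)) at_top sequentially"
    proof -
      assume ns: "\<not> summable (\<lambda>k. q (k + K))"
      show ?thesis unfolding filterlim_at_top
      proof
        fix Z
        obtain n where n: "Z < (\<Sum>k<n. q (k + K))"
        proof (rule ccontr)
          assume "\<not> thesis"
          then have "\<And>n. (\<Sum>k<n. q (k + K)) \<le> Z" using that by (meson not_le)
          then have "summable (\<lambda>k. q (k + K))"
            using q01 by (intro bounded_imp_summable[where B = Z])
              (auto simp: lessThan_Suc_atMost[symmetric] simp del: sum.lessThan_Suc)
          then show False using ns by simp
        qed
        have "Z \<le> (\<Sum>k<n'. q (k + K))" if "n \<le> n'" for n'
          using n sum_mono2[of "{..<n'}" "{..<n}" "\<lambda>k. q (k + K)"] q01 that by force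
        then show "\<forall>\<^sub>F n in sequentially. Z \<le> (\<Sum>k<n. q (k + K))" by (auto simp: eventually_sequentially)
      qed
    qed
    then have "filterlim (\<lambda>n. \<Sum>k\<in>{K..<n + K}. q k) at_top sequentially"
      using sum.shift_bounds_nat_ivl[of q 0 K] by (simp add: atLeast0LessThan)
    then show ?thesis
      using eventually_sequentially_seg[of "\<lambda>n. Z \<le> (\<Sum>k\<in>{K..<n}. q k)" K for Z]
      by (simp add: filterlim_at_top)
  qed

  define E where "E k x \<longleftrightarrow> real (ladder_epoch (m k) ((theta ^^ M k) x)) \<le> (1 - \<epsilon>) * real (N k)" for k x
  have E_meas [measurable]: "Measurable.pred W (E k)" for k unfolding E_def[abs_def] by measurable
  have often: "AE x in W. \<exists>k\<ge>K. E k x" for K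
  proof -
    have le: "W.prob {x. \<forall>k\<ge>K. \<not> E k x} \<le> exp (- (\<Sum>k\<in>{K..<n}. q k))" for n
    proof -
      \<comment> \<open>Blocks before \<open>K\<close> get a vacuous condition, since
        \<open>prob_blocks\<close> starts at block 0.\<close>
      let ?P = "\<lambda>k j. k < K \<or> \<not> real j \<le> (1 - \<epsilon>) * real (N k)"
      have "W.prob {x. \<forall>k\<ge>K. \<not> E k x} \<le> W.prob {x. \<forall>k<n. ?P k (ladder_epoch (m k) ((theta ^^ M k) x))}"
      proof (rule W.finite_measure_mono)
        show "{x. \<forall>k\<ge>K. \<not> E k x} \<subseteq> {x. \<forall>k<n. ?P k (ladder_epoch (m k) ((theta ^^ M k) x))}"
          by (auto simp: E_def not_less)
        show "{x. \<forall>k<n. ?P k (ladder_epoch (m k) ((theta ^^ M k) x))} \<in> sets W"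
          by (intro sets_Collect_W) measurable
      qed
      also have "\<dots> = (\<Prod>k<n. W.prob {x. ?P k (ladder_epoch (m k) x)})"
        unfolding M_def by (rule prob_blocks[where P = ?P])
      also have "\<dots> \<le> (\<Prod>k<n. exp (- (if k \<in> {K..<n} then q k else 0)))"
      proof (rule prod_mono)
        fix k assume k: "k \<in> {..<n}"
        have "W.prob {x. \<not> real (ladder_epoch (m k) x) \<le> (1 - \<epsilon>) * real (N k)} = 1 - q k"
          using W.prob_neg[of "\<lambda>x. real (ladder_epoch (m k) x) \<le> (1 - \<epsilon>) * real (N k)"]
            sets_ladder_epoch by (simp add: q_def)
        then show "0 \<le> W.prob {x. ?P k (ladder_epoch (m k) x)} \<and>
            W.prob {x. ?P k (ladder_epoch (m k) x)} \<le> exp (- (if k \<in> {K..<n} then q k else 0))"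
          using exp_ge_add_one_self[of "- q k"] k by (auto simp: not_less)
      qed
      also have "\<dots> = exp (- (\<Sum>k<n. if k \<in> {K..<n} then q k else 0))"
        by (simp add: exp_sum[symmetric] sum_negf)
      also have "(\<Sum>k<n. if k \<in> {K..<n} then q k else 0) = (\<Sum>k\<in>{K..<n}. q k)"
        by (intro sum.mono_neutral_cong_right) auto
      finally show ?thesis .
    qed
    have "(\<lambda>n. exp (- (\<Sum>k\<in>{K..<n}. q k))) \<longlonglongrightarrow> 0"
      using q_div[of K] by (intro filterlim_compose[OF exp_at_bot]) (simp add: filterlim_uminus_at_bot)
    then have "W.prob {x. \<forall>k\<ge>K. \<not> E k x} \<le> 0" by (rule LIMSEQ_le_const) (use le in auto)
    moreover have "0 \<le> W.prob {x. \<forall>k\<ge>K. \<not> E k x}" by simp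
    ultimately have "W.prob {x. \<forall>k\<ge>K. \<not> E k x} = 0" by linarith
    then have "AE x in W. \<not> (\<forall>k\<ge>K. \<not> E k x)" by (subst (asm) prob_zero_iff) simp_all
    then show ?thesis by simp
  qed
  then have "AE x in W. \<forall>K. \<exists>k\<ge>K. E k x" by (simp add: AE_all_countable)
  with early AE_ever_passing show ?thesis
  proof eventually_elim
    case (elim x)
    show ?case unfolding frequently_sequentially
    proof
      fix n0
      have "\<forall>\<^sub>F k in sequentially. n0 \<le> N k" using N_top by (simp add: filterlim_at_top)
      with elim(1) have "\<forall>\<^sub>F k in sequentially. n0 \<le> N k \<and> real (ladder_epoch (M k) x) \<le> \<epsilon> * real (N k)"
        by eventually_elim simp
      then obtain K where K: "\<And>k. K \<le> k \<Longrightarrow> n0 \<le> N k \<and> real (ladder_epoch (M k) x) \<le> \<epsilon> * real (N k)"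
        by (auto simp: eventually_sequentially)
      obtain k where k: "K \<le> k" "E k x" using elim(3) by blast
      \<comment> \<open>The earlier blocks take at most \<epsilon> N k steps and block k at most (1
        - \<epsilon>) N k.\<close>
      have "real (ladder_epoch (M k + m k) x) \<le> real (N k)"
        using K[OF k(1)] k(2) by (simp add: ladder_epoch_add E_def algebra_simps)
      then have "M k + m k < records x (N k)" using less_records_iff[OF elim(2)] by simp
      then have "c * g (N k) \<le> real (records x (N k))" using mm[of "N k"] by (simp add: m_def)
      then show "\<exists>n\<ge>n0. c * g n \<le> real (records x n)" using K[OF k(1)] by blast
    qed
  qed
qed

end

section \<open>Passage to the upper limit and to records above a level\<close>

lemma limsup_eqI:
  fixes h :: "nat \<Rightarrow> real"
  assumes upper: "\<And>e. 0 < e \<Longrightarrow> \<forall>\<^sub>F n in sequentially. h n \<le> c + e"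
    and lower: "\<And>e. 0 < e \<Longrightarrow> \<exists>\<^sub>F n in sequentially. c - e \<le> h n"
  shows "limsup (\<lambda>n. ereal (h n)) = ereal c"
proof (rule antisym)
  show "limsup (\<lambda>n. ereal (h n)) \<le> ereal c"
  proof (rule ereal_le_epsilon2)
    show "limsup (\<lambda>n. ereal (h n)) \<le> ereal c + ereal e" if "0 < e" for e
      using upper[OF that] by (intro Limsup_bounded) simp
  qed
  show "ereal c \<le> limsup (\<lambda>n. ereal (h n))"
  proof (rule ccontr)
    assume "\<not> ?thesis"
    then obtain d where d: "limsup (\<lambda>n. ereal (h n)) < ereal d" "ereal d < ereal c"
      using ereal_dense2 by (metis not_le)
    have "\<forall>\<^sub>F n in sequentially. ereal (h n) < ereal d" using d(1) by (rule Limsup_lessD)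
    moreover have "\<exists>\<^sub>F n in sequentially. c - (c - d) \<le> h n" using d(2) by (intro lower) simp
    ultimately show False by (simp add: frequently_def not_le)
  qed
qed

definition records_above :: "real \<Rightarrow> (nat \<Rightarrow> real) \<Rightarrow> nat \<Rightarrow> nat" where
  "records_above b x n = card {k\<in>{..n}. ladder x k \<and> b \<le> psum x k}"

lemma records_above_le: "records_above b x n \<le> records x n"
  unfolding records_above_def records_def by (intro card_mono) auto

text \<open>A record at step \<open>K\<close> or later is at least the sum at \<open>K\<close>, so
  only steps before \<open>K\<close> can be lost.\<close>

lemma records_le_records_above:
  assumes "b \<le> psum x K" shows "records x n \<le> records_above b x n + K"
proof -
  have "b \<le> psum x k" if "ladder x k" "K \<le> k" for k
    using that assms by (force simp: ladder_def)
  then have "{k\<in>{..n}. ladder x k} \<subseteq> {k\<in>{..n}. ladder x k \<and> b \<le> psum x k} \<union> {..<K}"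
    by (auto simp: not_less[symmetric])
  then have "records x n \<le> card ({k\<in>{..n}. ladder x k \<and> b \<le> psum x k} \<union> {..<K})"
    unfolding records_def by (intro card_mono) auto
  also have "\<dots> \<le> records_above b x n + card {..<K}"
    unfolding records_above_def by (rule card_Un_le)
  finally show ?thesis by simp
qed

context random_walk
begin

lemma AE_shift:
  assumes "Measurable.pred W P" "AE x in W. P x" shows "AE x in W. \<forall>j. P (shift j x)"
proof -
  have "AE x in W. P (shift j x)" for j
  proof -
    have "W.prob {x. P (shift j x)} = 1"
      using prob_shift[OF assms(1), of j] assms(2) prob_one_iff[OF assms(1)] by simp
    moreover have "Measurable.pred W (\<lambda>x. P (shift j x))"
      using assms(1) by measurable
    ultimately show ?thesis using prob_one_iff[of "\<lambda>x. P (shift j x)"] by simp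
  qed
  then show ?thesis by (simp add: AE_all_countable)
qed

text \<open>If no step is positive, a nonnegative sum forces every single step to be
  nonnegative.\<close>

lemma p_le_power:
  assumes "AE x in W. x 0 \<le> 0" shows "p n \<le> W.prob {x. 0 \<le> x 0} ^ n"
proof (induction n)
  case (Suc n)
  have nonpos: "AE x in W. \<forall>j. shift j x 0 \<le> 0" using assms by (intro AE_shift) measurable
  have "p (Suc n) \<le> W.prob {x. 0 \<le> x 0 \<and> 0 \<le> psum (shift 1 x) n}"
    unfolding p_def
  proof (rule W.finite_measure_mono_AE)
    show "AE x in W. x \<in> {x. 0 \<le> psum x (Suc n)} \<longrightarrow> x \<in> {x. 0 \<le> x 0 \<and> 0 \<le> psum (shift 1 x) n}"
      using nonpos
    proof eventually_elim
      case (elim x)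
      have "psum (shift 1 x) n \<le> 0" unfolding psum_def using elim by (intro sum_nonpos) (simp add: shift_def)
      moreover have "x 0 \<le> 0" using elim[rule_format, of 0] by simp
      moreover have "psum x (Suc n) = x 0 + psum (shift 1 x) n"
        using psum_add[of x 1 n] by (simp add: psum_def)
      ultimately show ?case by auto
    qed
  qed (intro sets_Collect_W, measurable)
  also have "\<dots> = W.prob {x. 0 \<le> x 0} * p n"
    unfolding p_def by (rule markov) auto
  also have "\<dots> \<le> W.prob {x. 0 \<le> x 0} ^ Suc n" using Suc by (simp add: mult_left_mono)
  finally show ?case .
qed (simp add: p_bounds)

text \<open>Otherwise all steps are nonpositive and, not being almost surely 0, nonnegative with
  probability below 1. Then \<open>p\<close> decays geometrically, against the divergence of the
  series.\<close>

lemma positive_step: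
  assumes "\<not> (AE x in W. x 0 = 0)" and "\<not> summable (\<lambda>k. p (Suc k) / real (Suc k))"
  shows "\<exists>\<epsilon>>0. 0 < W.prob {x. \<epsilon> < x 0}"
proof (rule ccontr)
  assume contr: "\<not> ?thesis"
  have "AE x in W. x 0 \<le> 1 / real (Suc n)" for n
  proof -
    have "0 \<le> W.prob {x. 1 / real (Suc n) < x 0}" by simp
    moreover have "\<not> 0 < W.prob {x. 1 / real (Suc n) < x 0}"
      using contr by (metis divide_pos_pos of_nat_0_less_iff zero_less_Suc zero_less_one)
    ultimately have "W.prob {x. 1 / real (Suc n) < x 0} = 0" by linarith
    then have "AE x in W. x \<notin> {x. 1 / real (Suc n) < x 0}"
      by (subst (asm) W.prob_eq_0) (intro sets_Collect_W, measurable)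
    then show ?thesis by (simp add: not_less)
  qed
  then have "AE x in W. \<forall>n. x 0 \<le> 1 / real (Suc n)" by (simp only: AE_all_countable) simp
  then have nonpos: "AE x in W. x 0 \<le> 0"
  proof eventually_elim
    case (elim x)
    have "(\<lambda>n. 1 / real (Suc n)) \<longlonglongrightarrow> 0" by (rule LIMSEQ_Suc[OF lim_1_over_n])
    then show ?case by (rule LIMSEQ_le_const) (use elim in auto)
  qed
  let ?r = "W.prob {x. 0 \<le> x 0}"
  have "?r \<noteq> 1"
  proof
    assume "?r = 1"
    then have "AE x in W. x \<in> {x. 0 \<le> x 0}"
      by (subst (asm) W.prob_eq_1) (intro sets_Collect_W, measurable)
    with nonpos have "AE x in W. x 0 = 0" by eventually_elim simp
    then show False using assms(1) by simp
  qed
  then have r: "?r < 1" "0 \<le> ?r" by (simp_all add: less_le)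
  have "summable (\<lambda>k. p (Suc k) / real (Suc k))"
  proof (rule summable_comparison_test')
    show "summable (\<lambda>k. ?r ^ Suc k)" using r by (subst summable_Suc_iff) simp
    fix k
    have "p (Suc k) / real (Suc k) \<le> p (Suc k)" using p_bounds[of "Suc k"] by (simp add: divide_le_eq mult_le_cancel_left1)
    also have "\<dots> \<le> ?r ^ Suc k" by (rule p_le_power[OF nonpos])
    finally show "norm (p (Suc k) / real (Suc k)) \<le> ?r ^ Suc k" using p_bounds[of "Suc k"] by simp
  qed
  then show False using assms(2) by simp
qed

end

context regular_walk
begin

definition lil_const :: real where
  "lil_const = Gamma (\<rho> + 1) / (rpow \<rho> \<rho> * rpow (1 - \<rho>) (1 - \<rho>))"

lemma lil_const_pos: "0 < lil_const"
  using Gamma_pos rho by (auto simp: lil_const_def rpow_def)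

text \<open>The optimal exponent is \<open>\<rho> / (1 - \<rho>)\<close>; it degenerates for \<open>\<rho> = 0\<close>.\<close>
lemma optimal_exponent:
  assumes "0 < \<rho>"
  shows "(\<rho> / (1 - \<rho>)) powr \<rho> / Gamma (\<rho> + 1) = 1 / ((1 - \<rho>) * lil_const)"
proof -
  have "(1 - \<rho>) powr (1 - \<rho>) * (1 - \<rho>) powr \<rho> = 1 - \<rho>"
    using rho by (simp add: powr_add[symmetric])
  then have "(1 - \<rho>) powr (1 - \<rho>) / (1 - \<rho>) = 1 / (1 - \<rho>) powr \<rho>"
    using rho by (simp add: field_simps)
  moreover have "1 / ((1 - \<rho>) * lil_const) = \<rho> powr \<rho> * ((1 - \<rho>) powr (1 - \<rho>) / (1 - \<rho>)) / Gamma (\<rho> + 1)"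
    using assms rho by (simp add: lil_const_def rpow_def)
  ultimately show ?thesis using assms rho by (simp add: powr_divide)
qed

text \<open>At a = \<rho> / (1 - \<rho>) and c = \<open>lil_const\<close> there is equality, so any
  larger c is strict. For \<rho> = 0 the condition reads 1 + a < c and a small a does.\<close>

lemma upper_exponent:
  assumes "lil_const < c" obtains a where "0 < a" "1 + a < c * a powr \<rho> / Gamma (\<rho> + 1)"
proof (cases "\<rho> = 0")
  case True
  have "lil_const = 1" unfolding lil_const_def rpow_def by (simp add: True)
  then have "1 < c" using assms by simp
  then show thesis using True by (intro that[of "(c - 1) / 2"]) (auto simp: field_simps)
next
  case False
  then have r: "0 < \<rho>" using rho by simp
  have "1 + \<rho> / (1 - \<rho>) = 1 / (1 - \<rho>)" using rho by (simp add: field_simps)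
  also have "\<dots> < c / lil_const * (1 / (1 - \<rho>))"
    using mult_strict_right_mono[of 1 "c / lil_const" "1 / (1 - \<rho>)"] assms lil_const_pos rho by simp
  also have "\<dots> = c * ((\<rho> / (1 - \<rho>)) powr \<rho> / Gamma (\<rho> + 1))"
    unfolding optimal_exponent[OF r] by (simp add: mult.commute)
  finally show thesis using r rho by (intro that[of "\<rho> / (1 - \<rho>)"]) auto
qed

text \<open>At the optimum both conditions become equalities for c = \<open>lil_const\<close>, so
  one choice of a serves both. For \<rho> = 0 they reduce to 0 < a and c < 1.\<close>

lemma lower_exponent:
  assumes "0 < c" "c < lil_const"
  obtains a where "0 < a" "\<rho> * (c * (a powr \<rho> / Gamma (\<rho> + 1))) < a"
    "(1 - \<rho>) * (c * (a powr \<rho> / Gamma (\<rho> + 1))) < 1"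
proof (cases "\<rho> = 0")
  case True
  have "lil_const = 1" unfolding lil_const_def rpow_def by (simp add: True)
  then have "c < 1" using assms by simp
  then show thesis using True by (intro that[of 1]) auto
next
  case False
  then have r: "0 < \<rho>" using rho by simp
  have "c * (1 / ((1 - \<rho>) * lil_const)) < 1 / (1 - \<rho>)"
    using mult_strict_right_mono[of "c / lil_const" 1 "1 / (1 - \<rho>)"] assms lil_const_pos rho
    by (simp add: mult.commute)
  then have less: "c * ((\<rho> / (1 - \<rho>)) powr \<rho> / Gamma (\<rho> + 1)) < 1 / (1 - \<rho>)"
    unfolding optimal_exponent[OF r] .
  show thesis
  proof (rule that)
    show "0 < \<rho> / (1 - \<rho>)" using r rho by simp
    show "\<rho> * (c * ((\<rho> / (1 - \<rho>)) powr \<rho> / Gamma (\<rho> + 1))) < \<rho> / (1 - \<rho>)"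
      using mult_strict_left_mono[OF less r] by simp
    show "(1 - \<rho>) * (c * ((\<rho> / (1 - \<rho>)) powr \<rho> / Gamma (\<rho> + 1))) < 1"
      using mult_strict_left_mono[OF less, of "1 - \<rho>"] rho by simp
  qed
qed

theorem AE_limsup_records_above:
  assumes "\<not> (AE x in W. x 0 = 0)"
  shows "AE x in W. limsup (\<lambda>n. ereal (real (records_above b x n) / g n)) = ereal lil_const"
proof -
  have upper: "AE x in W. \<forall>\<^sub>F n in sequentially. real (records x n) \<le> (lil_const + 1 / real (Suc k)) * g n" for k
  proof -
    \<comment> \<open>Half of the allowed excess moves c above \<open>lil_const\<close>; the other
      half provides the ratio above 1 demanded by \<open>AE_records_upper\<close>. Discrete k keeps
      the exceptional sets countable.\<close>
    define c where "c = lil_const + 1 / (2 * real (Suc k))"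
    have c: "lil_const < c" "0 < c" "c < lil_const + 1 / real (Suc k)"
      using lil_const_pos by (auto simp: c_def add_pos_pos frac_less2)
    obtain a where a: "0 < a" "1 + a < c * a powr \<rho> / Gamma (\<rho> + 1)" using upper_exponent[OF c(1)] .
    have "1 < (lil_const + 1 / real (Suc k)) / c" using c by simp
    from AE_records_upper[OF a(1) c(2) a(2) this] show ?thesis using c by simp
  qed
  \<comment> \<open>The added 2 keeps the factor positive at k = 0, as
    \<open>AE_records_lower\<close> requires a positive c.\<close>
  have lower: "AE x in W. \<exists>\<^sub>F n in sequentially. lil_const * (1 - 1 / (real k + 2)) * g n \<le> real (records x n)" for k
  proof -
    define c where "c = lil_const * (1 - 1 / (real k + 2))"
    have c: "0 < c" "c < lil_const" using lil_const_pos by (auto simp: c_def)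
    obtain a where "0 < a" "\<rho> * (c * (a powr \<rho> / Gamma (\<rho> + 1))) < a"
      "(1 - \<rho>) * (c * (a powr \<rho> / Gamma (\<rho> + 1))) < 1" using lower_exponent[OF c] .
    from AE_records_lower[OF this(1) c(1) refl this(2,3)] show ?thesis unfolding c_def .
  qed
  obtain \<epsilon> where "0 < \<epsilon>" "0 < W.prob {x. \<epsilon> < x 0}" using positive_step[OF assms p_div] by blast
  then have unbounded: "AE x in W. \<forall>b. \<exists>n. b \<le> psum x n" by (intro AE_walk_unbounded_above)
  have g_pos: "\<forall>\<^sub>F n in sequentially. 0 < g n" using g_top by (simp add: filterlim_at_top_dense)
  have "AE x in W. \<forall>k. \<forall>\<^sub>F n in sequentially. real (records x n) \<le> (lil_const + 1 / real (Suc k)) * g n"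
    using upper by (simp only: AE_all_countable) simp
  moreover have "AE x in W. \<forall>k. \<exists>\<^sub>F n in sequentially. lil_const * (1 - 1 / (real k + 2)) * g n \<le> real (records x n)"
    using lower by (simp only: AE_all_countable) simp
  ultimately show ?thesis using unbounded
  proof eventually_elim
    case (elim x)
    show ?case
    proof (rule limsup_eqI)
      fix e :: real assume e: "0 < e"
      obtain k where k: "inverse (real (Suc k)) < e" using reals_Archimedean[OF e] by blast
      show "\<forall>\<^sub>F n in sequentially. real (records_above b x n) / g n \<le> lil_const + e"
        using elim(1)[rule_format, of k] g_pos
      proof eventually_elim
        case (elim n)
        have "real (records_above b x n) \<le> real (records x n)" using records_above_le by simp
        also have "\<dots> \<le> (lil_const + 1 / real (Suc k)) * g n" by (rule elim)
        also have "\<dots> \<le> (lil_const + e) * g n"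
          using k elim by (intro mult_right_mono) (auto simp: inverse_eq_divide)
        finally show ?case using elim by (simp add: divide_le_eq)
      qed
    next
      fix e :: real assume e: "0 < e"
      then have e': "0 < e / (2 * lil_const)" using lil_const_pos by simp
      obtain k where "inverse (real (Suc k)) < e / (2 * lil_const)" using reals_Archimedean[OF e'] by blast
      moreover have "1 / (real k + 2) \<le> inverse (real (Suc k))" by (simp add: field_simps)
      ultimately have "1 / (real k + 2) < e / (2 * lil_const)" by linarith
      from mult_strict_left_mono[OF this lil_const_pos]
      have k: "lil_const * (1 / (real k + 2)) < e / 2" using lil_const_pos by simp
      obtain K where K: "b \<le> psum x K" using elim(3) by blast
      have "\<forall>\<^sub>F n in sequentially. 2 * real K / e \<le> g n" using g_top by (simp add: filterlim_at_top)
      with g_pos have "\<forall>\<^sub>F n in sequentially. 0 < g n \<and> real K \<le> e / 2 * g n"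
        by eventually_elim (use e in \<open>simp add: field_simps\<close>)
      with elim(2)[rule_format, of k]
      have "\<exists>\<^sub>F n in sequentially. lil_const * (1 - 1 / (real k + 2)) * g n \<le> real (records x n)
          \<and> 0 < g n \<and> real K \<le> e / 2 * g n"
        by (rule frequently_eventually_frequently)
      then show "\<exists>\<^sub>F n in sequentially. lil_const - e \<le> real (records_above b x n) / g n"
      proof (rule frequently_elim1)
        fix n
        assume n: "lil_const * (1 - 1 / (real k + 2)) * g n \<le> real (records x n) \<and> 0 < g n \<and> real K \<le> e / 2 * g n"
        have "(lil_const - e) * g n \<le> (lil_const * (1 - 1 / (real k + 2)) - e / 2) * g n"
          using k n by (intro mult_right_mono) (auto simp: right_diff_distrib)
        also have "\<dots> \<le> real (records x n) - real K" using n by (simp add: left_diff_distrib)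
        also have "\<dots> \<le> real (records_above b x n)" using records_le_records_above[OF K, of n] by linarith
        finally show "lil_const - e \<le> real (records_above b x n) / g n" using n by (simp add: le_divide_eq)
      qed
    qed
  qed
qed

end

section \<open>Transfer to the given probability space\<close>

lemma walk_eq_psum: "walk X x n \<omega> = x + psum (\<lambda>i. X (Suc i) \<omega>) n"
  by (simp add: walk_def psum_def sum.atLeast1_atMost_eq)

lemma num_weak_records_eq:
  "num_weak_records X x\<^sub>1 x\<^sub>2 n \<omega> = records_above (x\<^sub>2 - x\<^sub>1) (\<lambda>i. X (Suc i) \<omega>) n"
proof -
  let ?\<xi> = "\<lambda>i. X (Suc i) \<omega>"
  have "weak_record X x\<^sub>1 k \<omega> \<longleftrightarrow> ladder ?\<xi> k" for k
  proof -
    have "weak_record X x\<^sub>1 k \<omega> \<longleftrightarrow> Max ((\<lambda>j. walk X x\<^sub>1 j \<omega>) ` {0..k}) = walk X x\<^sub>1 k \<omega>"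
      unfolding weak_record_def by (rule eq_commute)
    also have "\<dots> \<longleftrightarrow> (\<forall>j\<in>{0..k}. walk X x\<^sub>1 j \<omega> \<le> walk X x\<^sub>1 k \<omega>)"
      by (subst Max_eq_iff) auto
    also have "\<dots> \<longleftrightarrow> ladder ?\<xi> k" by (auto simp: ladder_def walk_eq_psum)
    finally show ?thesis .
  qed
  then show ?thesis
    unfolding num_weak_records_def records_above_def
    by (intro arg_cong[where f = card]) (auto simp: walk_eq_psum)
qed

text \<open>Nothing is assumed about \<open>X 0\<close>, so the joint law is first taken on the
  indices from 1 on and then reindexed along \<open>Suc\<close>.\<close>

lemma distr_iid_sequence:
  assumes "prob_space M" "iid_from_1 M X"
  shows "(\<lambda>\<omega> i. X (Suc i) \<omega>) \<in> measurable M seq_borel"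
    "distr M seq_borel (\<lambda>\<omega> i. X (Suc i) \<omega>) = PiM UNIV (\<lambda>_. distr M borel (X 1))"
proof -
  interpret prob_space M by fact
  have ind: "indep_vars (\<lambda>_. borel) X {1..}" and same: "\<And>i. 1 \<le> i \<Longrightarrow> distr M borel (X i) = distr M borel (X 1)"
    using assms(2) unfolding iid_from_1_def by blast+
  have rv: "random_variable borel (X i)" if "i \<in> {1..}" for i
    using ind that by (auto simp: indep_vars_def)
  let ?D = "distr M borel (X 1)"
  show meas: "(\<lambda>\<omega> i. X (Suc i) \<omega>) \<in> measurable M seq_borel"
    by (rule measurable_PiM_single') (auto intro: rv)
  have joint: "distr M (PiM {1..} (\<lambda>_. borel)) (\<lambda>\<omega>. \<lambda>i\<in>{1..}. X i \<omega>) = PiM {1..} (\<lambda>_. ?D)"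
  proof -
    have "distr M (PiM {1..} (\<lambda>_. borel)) (\<lambda>\<omega>. \<lambda>i\<in>{1..}. X i \<omega>) = PiM {1..} (\<lambda>i. distr M borel (X i))"
      using indep_vars_iff_distr_eq_PiM'[of "{1..}" X "\<lambda>_. borel"] rv ind by auto
    also have "\<dots> = PiM {1..} (\<lambda>_. ?D)" by (intro PiM_cong same) auto
    finally show ?thesis .
  qed
  have X_meas: "(\<lambda>\<omega>. \<lambda>i\<in>{1..}. X i \<omega>) \<in> measurable M (PiM {1..} (\<lambda>_. borel))"
    by (intro measurable_restrict rv)
  have Suc_meas: "(\<lambda>x. \<lambda>i\<in>UNIV. x (Suc i)) \<in> measurable (PiM {1::nat..} (\<lambda>_. borel)) seq_borel"
    by (intro measurable_restrict measurable_component_singleton) auto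
  have "distr M seq_borel (\<lambda>\<omega> i. X (Suc i) \<omega>) =
      distr (distr M (PiM {1..} (\<lambda>_. borel)) (\<lambda>\<omega>. \<lambda>i\<in>{1..}. X i \<omega>)) seq_borel (\<lambda>x. \<lambda>i\<in>UNIV. x (Suc i))"
    by (subst distr_distr[OF Suc_meas X_meas]) (simp add: comp_def restrict_UNIV)
  also have "\<dots> = distr (PiM {1..} (\<lambda>_. ?D)) (PiM UNIV (\<lambda>_. ?D)) (\<lambda>x. \<lambda>i\<in>UNIV. x (Suc i))"
    unfolding joint by (intro distr_cong sets_PiM_cong) auto
  also have "\<dots> = PiM UNIV (\<lambda>_. ?D)"
    by (rule distr_PiM_reindex) (use prob_space_distr[OF rv[of 1]] in auto)
  finally show "distr M seq_borel (\<lambda>\<omega> i. X (Suc i) \<omega>) = PiM UNIV (\<lambda>_. ?D)" .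
qed

theorem theorem8:
  fixes M :: "'a measure" and X :: "nat \<Rightarrow> 'a \<Rightarrow> real"
    and \<rho> x\<^sub>1 x\<^sub>2 :: real
  assumes "prob_space M"
    and "iid_from_1 M X"
    and "nondegenerate M (X 1)"
    and "(0 < \<rho> \<and> \<rho> < 1 \<and> prob_nonneg M X \<longlonglongrightarrow> \<rho>) \<or>
         (\<rho> = 0 \<and> prob_nonneg M X \<longlonglongrightarrow> 0 \<and>
          (\<Sum>k. ennreal (prob_nonneg M X (Suc k) / real (Suc k))) = \<infinity>)"
  shows "AE \<omega> in M.
    limsup (\<lambda>n. ereal (real (num_weak_records X x\<^sub>1 x\<^sub>2 n \<omega>) /
      (f_fun M X \<rho> (real n / ln (ln (f_fun M X \<rho> (real n)))) * ln (ln (f_fun M X \<rho> (real n))))))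
    = ereal (Gamma (\<rho> + 1) / (rpow \<rho> \<rho> * rpow (1 - \<rho>) (1 - \<rho>)))"
proof -
  interpret M: prob_space M by fact
  define D where "D = distr M borel (X 1)"
  let ?\<xi> = "\<lambda>\<omega> i. X (Suc i) \<omega>"
  note \<xi> = distr_iid_sequence[OF assms(1,2), folded D_def]
  have "X 1 \<in> borel_measurable M"
    using measurable_compose[OF \<xi>(1) measurable_component_singleton[of 0 UNIV "\<lambda>_. borel"]] by simp
  then interpret D: prob_space D unfolding D_def by (rule M.prob_space_distr)
  interpret random_walk D by unfold_locales (simp add: D_def)
  have W: "distr M seq_borel ?\<xi> = W" using \<xi>(2) by (simp add: W_def)
  have p: "prob_nonneg M X = p"
  proof
    fix k
    have "p k = measure (distr M seq_borel ?\<xi>) {x. 0 \<le> psum x k}" by (simp add: p_def W)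
    also have "\<dots> = measure M (?\<xi> -` {x. 0 \<le> psum x k} \<inter> space M)"
      by (intro measure_distr \<xi>(1)) (subst sets_W[symmetric], intro sets_Collect_W, measurable)
    also have "?\<xi> -` {x. 0 \<le> psum x k} \<inter> space M = {\<omega> \<in> space M. walk X 0 k \<omega> \<ge> 0}"
      by (auto simp: walk_eq_psum)
    finally show "prob_nonneg M X k = p k" by (simp add: prob_nonneg_def)
  qed
  interpret regular_walk D \<rho>
  proof unfold_locales
    show "0 \<le> \<rho>" "\<rho> < 1" "p \<longlonglongrightarrow> \<rho>" using assms(4) by (auto simp: p)
    show "\<not> summable (\<lambda>k. p (Suc k) / real (Suc k))"
    proof
      assume sum: "summable (\<lambda>k. p (Suc k) / real (Suc k))"
      show False using assms(4)
      proof
        assume "0 < \<rho> \<and> \<rho> < 1 \<and> prob_nonneg M X \<longlonglongrightarrow> \<rho>"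
        then have rho: "0 < \<rho>" and lim: "(\<lambda>k. p (Suc k)) \<longlonglongrightarrow> \<rho>" by (auto simp: p intro: LIMSEQ_Suc)
        have "\<forall>\<^sub>F k in sequentially. \<rho> / 2 < p (Suc k)"
          using lim by (rule order_tendstoD) (use rho in simp)
        then have "\<forall>\<^sub>F k in sequentially. norm (\<rho> / 2 * inverse (real (Suc k))) \<le> p (Suc k) / real (Suc k)"
        proof eventually_elim
          case (elim k)
          have "\<rho> / 2 * inverse (real (Suc k)) \<le> p (Suc k) * inverse (real (Suc k))"
            using elim by (intro mult_right_mono) auto
          then show ?case unfolding divide_inverse[of "p (Suc k)"] using rho by (simp del: of_nat_Suc)
        qed
        then have "summable (\<lambda>k. \<rho> / 2 * inverse (real (Suc k)))" by (rule summable_comparison_test_ev[OF _ sum])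
        then have "summable (\<lambda>k. inverse (real (Suc k)))" using rho by (subst (asm) summable_cmult_iff) simp
        then show False using not_summable_harmonic[where 'a = real] by (subst (asm) summable_Suc_iff) simp
      next
        assume "\<rho> = 0 \<and> prob_nonneg M X \<longlonglongrightarrow> 0 \<and> (\<Sum>k. ennreal (prob_nonneg M X (Suc k) / real (Suc k))) = \<infinity>"
        then have "(\<Sum>k. ennreal (p (Suc k) / real (Suc k))) = \<infinity>" by (simp add: p)
        then show False using suminf_ennreal2[OF _ sum] p_bounds by simp
      qed
    qed
  qed
  have f: "f_fun M X \<rho> t = ff t" if t: "1 \<le> t" for t
  proof -
    let ?y = "1 - 1 / t"
    have y: "0 \<le> ?y" "?y < 1" using t by auto
    have "(\<lambda>k. ?y ^ Suc k / real (Suc k) * p (Suc k) - ?y ^ Suc k / real (Suc k) * \<rho>) sums (expo ?y - (- ln (1 - ?y)) * \<rho>)"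
      using y by (intro sums_diff expo_sums sums_mult2 log_series_sums) auto
    then have "(\<Sum>k. ?y ^ Suc k / real (Suc k) * (p (Suc k) - \<rho>)) = expo ?y - \<rho> * ln t"
      using t by (simp add: sums_iff right_diff_distrib ln_div)
    then have "C_fun M X \<rho> ?y = exp (expo ?y - \<rho> * ln t)" by (simp add: C_fun_def p)
    then show ?thesis using t by (simp add: f_fun_def ff_def powr_def exp_add[symmetric])
  qed
  \<comment> \<open>\<open>f_fun\<close> is identified with \<open>ff\<close> for arguments from 1
    on, and n / L n is eventually in that range.\<close>
  have denom: "\<forall>\<^sub>F n in sequentially. f_fun M X \<rho> (real n / ln (ln (f_fun M X \<rho> (real n)))) * ln (ln (f_fun M X \<rho> (real n))) = g n"
  proof -
    have "\<forall>\<^sub>F n in sequentially. 1 \<le> real n / L n" using n_div_L_top by (simp add: filterlim_at_top)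
    then show ?thesis using eventually_ge_at_top[of 1]
      by eventually_elim (simp add: f g_def L_def)
  qed
  have "\<not> (AE x in W. x 0 = 0)"
  proof
    assume "AE x in W. x 0 = 0"
    then have "AE x in distr M seq_borel ?\<xi>. x 0 = 0" unfolding W .
    from AE_distrD[OF \<xi>(1) this] have "AE \<omega> in M. X 1 \<omega> = 0" by simp
    then show False using assms(3) by (auto simp: nondegenerate_def)
  qed
  from AE_limsup_records_above[OF this, of "x\<^sub>2 - x\<^sub>1"]
  have "AE x in distr M seq_borel ?\<xi>. limsup (\<lambda>n. ereal (real (records_above (x\<^sub>2 - x\<^sub>1) x n) / g n)) = ereal lil_const"
    unfolding W .
  from AE_distrD[OF \<xi>(1) this] show ?thesis
  proof eventually_elim
    case (elim \<omega>)
    have "limsup (\<lambda>n. ereal (real (num_weak_records X x\<^sub>1 x\<^sub>2 n \<omega>) /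
        (f_fun M X \<rho> (real n / ln (ln (f_fun M X \<rho> (real n)))) * ln (ln (f_fun M X \<rho> (real n))))))
      = limsup (\<lambda>n. ereal (real (records_above (x\<^sub>2 - x\<^sub>1) (?\<xi> \<omega>) n) / g n))"
      by (rule Limsup_eq) (use denom in eventually_elim, simp add: num_weak_records_eq)
    with elim show ?case by (simp add: lil_const_def)
  qed
qed

end
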